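(* Every P$'''$-graph is a P$''$-graph.
   Context: A graph is a pair of functions $W,E\colon A\to V$ with $A\cap V=\emptyset$. Let $X$ range over $\{W,E\}$, $\bar W=E$, $\bar E=W$. A vertex $v$ is an $X$-vertex if no edge $a$ has $\bar X(a)=v$; $X(D)$ is the set of $X$-vertices; inner vertices are neither. An edge $a$ is an $X$-edge if $X(a)$ is an $X$-vertex; inner edges are neither. $W$-$E$-functional: for every $X$-edge $a$ and edge $b\ne a$, $X(a)\ne X(b)$. A semipath from $v_0$ to $v_n$ is $v_0a_1v_1\dots a_nv_n$ ($n\ge0$) with $\{W(a_i),E(a_i)\}=\{v_{i-1},v_i\}$ and no repeated vertex; weakly connected: any two distinct vertices joined by a semipath; a cycle is a directed closed walk $v_0a_1\dots a_nv_n$, $n\ge1$, $W(a_i)=v_{i-1}$, $E(a_i)=v_i$, vertices distinct except $v_0=v_n$. A D-graph is a finite, acyclic, $W$-$E$-functional, weakly connected graph with an inner vertex; basic if it has exactly one inner vertex. Juncture: for D-graphs $D_W=(W_W,E_W\colon A_W\to V_W)$, $D_E=(W_E,E_E\colon A_E\to V_E)$, $D_W\Box D_E$ is defined when $C=A_W\cap A_E\ne\emptyset$, $E_W(a)=W_E(a)$ for $a\in C$, each $a\in C$ is an $E$-edge of $D_W$ and a $W$-edge of $D_E$, and $V_W\cap V_E=V_C:=\{E_W(a)\mid a\in C\}$; it has edges $A_W\cup A_E$, vertices $(V_W\cup V_E)\setminus V_C$, $W(a)=W_W(a)$ if $a\in A_W$ else $W_E(a)$, $E(a)=E_E(a)$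 if $a\in A_E$ else $E_W(a)$. A list is a finite sequence of distinct elements. Nonempty lists are compatible if they are $\Phi_1\Xi\Psi_1$ and $\Phi_2\Xi\Psi_2$ with $\Xi$ nonempty, $\Phi_1,\Phi_2,\Psi_1,\Psi_2,\Xi$ pairwise disjoint, at least one of $\Phi_1,\Phi_2$ empty and at least one of $\Psi_1,\Psi_2$ empty. $\Gamma\colon x-y-z$ means distinct $x,y,z$ occur in $\Gamma$ in this order or its reverse. $[u,v]$ is the set of semipaths from $u$ to $v$, $[u]_X=\bigcup_{v\in X(D)}[u,v]$; semipaths intersect if they share a vertex. For distinct $X$-vertices $u,v,w$, $\psi_X(v,u,w)$ means every semipath in $[v,w]$ intersects every semipath in $[u]_{\bar X}$. A list $\Lambda$ of $X(D)$ is grounded in $D$ if $\Lambda\colon v-u-w$ implies $\psi_X(v,u,w)$. $D_W,D_E$ with $D_W\Box D_E$ defined are P-compatible if some list of $E(D_W)$ grounded in $D_W$ and some list of $W(D_E)$ grounded in $D_E$ are compatible. P$''$-graphs: basic D-graphs are P$''$-graphs; if $D_W,D_E$ are P-compatible P$''$-graphs then $D_W\Box D_E$ is a P$''$-graph. Cocycles: for a set $S$ of inner edges of a D-graph $D$, removing $S$ (keeping all vertices) leaves weakly connected components $D_1,\dots,D_n$; $C_S(D)$ is the directed graph on these with an arc $(D_i,D_j)$ iff $i\ne j$ and some $a\in S$ has $W(a)$ in $D_i$, $E(a)$ in $D_j$. $S$ is a strict cutset if $n\ge2$, each $a\in S$ has $W(a),E(a)$ in distinct components, and $C_S(D)$ is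 acyclic; a cocycle is a strict cutset with $n=2$. Cutting $D$ through a cocycle $C$ (components $D_1\ni W(a)$, $D_2\ni E(a)$ for $a\in C$): $D_W$ is $D_1$ plus the edges of $C$ and new vertices $v_a$ with $W(a)$ as in $D$ and $E(a)=v_a$; $D_E$ is $D_2$ plus the edges of $C$ and the same $v_a$ with $E(a)$ as in $D$ and $W(a)=v_a$. A D-graph $D$ is a P$'''$-graph if for every cocycle $C$ of $D$ the D-graphs obtained by cutting $D$ through $C$ are P-compatible. *)

theory Defs
  imports
    "Graph_Theory.Digraph_Component"
    "HOL-Library.Sublist"
    "HOL-Library.Infinite_Typeclass"
begin

text \<open>
  A graph is a record of type \<^typ>\<open>('v, 'a) pre_digraph\<close>: the function W is the restriction of
  \<^const>\<open>tail\<close> to the arcs and E is the restriction of \<^const>\<open>head\<close>.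
  Edges and vertices have different types, so edge sets and vertex sets are always disjoint.
  The values of \<^const>\<open>tail\<close> and \<^const>\<open>head\<close> outside the arcs carry no meaning.
\<close>

section \<open>D-graphs\<close>

datatype side = West | East

fun opp :: "side \<Rightarrow> side" where
  "opp West = East"
| "opp East = West"

fun endp :: "side \<Rightarrow> ('v, 'a) pre_digraph \<Rightarrow> 'a \<Rightarrow> 'v" where
  "endp West D = tail D"
| "endp East D = head D"

definition side_verts :: "side \<Rightarrow> ('v, 'a) pre_digraph \<Rightarrow> 'v set" where
  "side_verts X D = {v \<in> verts D. \<not> (\<exists>a \<in> arcs D. endp (opp X) D a = v)}"

definition inner_verts :: "('v, 'a) pre_digraph \<Rightarrow> 'v set" where
  "inner_verts D = verts D - (side_verts West D \<union> side_verts East D)"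

definition side_arcs :: "side \<Rightarrow> ('v, 'a) pre_digraph \<Rightarrow> 'a set" where
  "side_arcs X D = {a \<in> arcs D. endp X D a \<in> side_verts X D}"

definition inner_arcs :: "('v, 'a) pre_digraph \<Rightarrow> 'a set" where
  "inner_arcs D = arcs D - (side_arcs West D \<union> side_arcs East D)"

definition WE_functional :: "('v, 'a) pre_digraph \<Rightarrow> bool" where
  "WE_functional D \<longleftrightarrow>
     (\<forall>X. \<forall>a \<in> side_arcs X D. \<forall>b \<in> arcs D. b \<noteq> a \<longrightarrow> endp X D a \<noteq> endp X D b)"

text \<open>
  The semipath v0 a1 v1 ... an vn is the pair of lists ([v0, ..., vn], [a1, ..., an]).
\<close>

definition semipath :: "('v, 'a) pre_digraph \<Rightarrow> 'v list \<times> 'a list \<Rightarrow> bool" where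
  "semipath D p \<longleftrightarrow> (case p of (vs, as) \<Rightarrow>
     length vs = Suc (length as) \<and> set vs \<subseteq> verts D \<and> set as \<subseteq> arcs D \<and> distinct vs \<and>
     (\<forall>i < length as. {tail D (as ! i), head D (as ! i)} = {vs ! i, vs ! Suc i}))"

definition semipaths :: "('v, 'a) pre_digraph \<Rightarrow> 'v \<Rightarrow> 'v \<Rightarrow> ('v list \<times> 'a list) set" where
  "semipaths D u v = {p. semipath D p \<and> hd (fst p) = u \<and> last (fst p) = v}"

definition semipaths_to_side ::
    "side \<Rightarrow> ('v, 'a) pre_digraph \<Rightarrow> 'v \<Rightarrow> ('v list \<times> 'a list) set" where
  "semipaths_to_side X D u = (\<Union>v \<in> side_verts X D. semipaths D u v)"

definition intersecting :: "'v list \<times> 'a list \<Rightarrow> 'v list \<times> 'a list \<Rightarrow> bool" where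
  "intersecting p q \<longleftrightarrow> set (fst p) \<inter> set (fst q) \<noteq> {}"

definition weakly_connected :: "('v, 'a) pre_digraph \<Rightarrow> bool" where
  "weakly_connected D \<longleftrightarrow> (\<forall>u \<in> verts D. \<forall>v \<in> verts D. u \<noteq> v \<longrightarrow> semipaths D u v \<noteq> {})"

definition acyclic_digraph :: "('v, 'a) pre_digraph \<Rightarrow> bool" where
  "acyclic_digraph D \<longleftrightarrow> \<not> (\<exists>p. pre_digraph.cycle D p)"

definition D_graph :: "('v, 'a) pre_digraph \<Rightarrow> bool" where
  "D_graph D \<longleftrightarrow> fin_digraph D \<and> acyclic_digraph D \<and> WE_functional D \<and>
     weakly_connected D \<and> inner_verts D \<noteq> {}"

definition basic_D_graph :: "('v, 'a) pre_digraph \<Rightarrow> bool" where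
  "basic_D_graph D \<longleftrightarrow> D_graph D \<and> (\<exists>!v. v \<in> inner_verts D)"

section \<open>Juncture\<close>

definition juncture_verts :: "('v, 'a) pre_digraph \<Rightarrow> ('v, 'a) pre_digraph \<Rightarrow> 'v set" where
  "juncture_verts DW DE = head DW ` (arcs DW \<inter> arcs DE)"

definition juncture_defined :: "('v, 'a) pre_digraph \<Rightarrow> ('v, 'a) pre_digraph \<Rightarrow> bool" where
  "juncture_defined DW DE \<longleftrightarrow>
     D_graph DW \<and> D_graph DE \<and>
     arcs DW \<inter> arcs DE \<noteq> {} \<and>
     (\<forall>a \<in> arcs DW \<inter> arcs DE.
        head DW a = tail DE a \<and> a \<in> side_arcs East DW \<and> a \<in> side_arcs West DE) \<and>
     verts DW \<inter> verts DE = juncture_verts DW DE"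

definition juncture ::
    "('v, 'a) pre_digraph \<Rightarrow> ('v, 'a) pre_digraph \<Rightarrow> ('v, 'a) pre_digraph" where
  "juncture DW DE =
     \<lparr>verts = (verts DW \<union> verts DE) - juncture_verts DW DE,
      arcs = arcs DW \<union> arcs DE,
      tail = (\<lambda>a. if a \<in> arcs DW then tail DW a else tail DE a),
      head = (\<lambda>a. if a \<in> arcs DE then head DE a else head DW a)\<rparr>"

section \<open>Grounded and compatible lists\<close>

definition compatible_lists :: "'v list \<Rightarrow> 'v list \<Rightarrow> bool" where
  "compatible_lists xs ys \<longleftrightarrow>
     (\<exists>\<Phi>1 \<Phi>2 \<Psi>1 \<Psi>2 \<Xi>.
        xs = \<Phi>1 @ \<Xi> @ \<Psi>1 \<and> ys = \<Phi>2 @ \<Xi> @ \<Psi>2 \<and> \<Xi> \<noteq> [] \<and>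
        distinct (\<Phi>1 @ \<Phi>2 @ \<Psi>1 @ \<Psi>2 @ \<Xi>) \<and>
        (\<Phi>1 = [] \<or> \<Phi>2 = []) \<and> (\<Psi>1 = [] \<or> \<Psi>2 = []))"

definition in_between :: "'v list \<Rightarrow> 'v \<Rightarrow> 'v \<Rightarrow> 'v \<Rightarrow> bool" where
  "in_between xs x y z \<longleftrightarrow> distinct [x, y, z] \<and> (subseq [x, y, z] xs \<or> subseq [z, y, x] xs)"

definition separates :: "side \<Rightarrow> ('v, 'a) pre_digraph \<Rightarrow> 'v \<Rightarrow> 'v \<Rightarrow> 'v \<Rightarrow> bool" where
  "separates X D v u w \<longleftrightarrow>
     (\<forall>p \<in> semipaths D v w. \<forall>q \<in> semipaths_to_side (opp X) D u. intersecting p q)"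

text \<open>A list of a set enumerates the whole set, without repetitions.\<close>

definition grounded :: "side \<Rightarrow> ('v, 'a) pre_digraph \<Rightarrow> 'v list \<Rightarrow> bool" where
  "grounded X D xs \<longleftrightarrow> distinct xs \<and> set xs = side_verts X D \<and>
     (\<forall>v u w. in_between xs v u w \<longrightarrow> separates X D v u w)"

definition P_compatible :: "('v, 'a) pre_digraph \<Rightarrow> ('v, 'a) pre_digraph \<Rightarrow> bool" where
  "P_compatible DW DE \<longleftrightarrow> juncture_defined DW DE \<and>
     (\<exists>xs ys. grounded East DW xs \<and> grounded West DE ys \<and> compatible_lists xs ys)"

inductive P2_graph :: "('v, 'a) pre_digraph \<Rightarrow> bool" where
  basic: "basic_D_graph D \<Longrightarrow> P2_graph D"
| junct: "P2_graph DW \<Longrightarrow> P2_graph DE \<Longrightarrow> P_compatible DW DE \<Longrightarrow> P2_graph (juncture DW DE)"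

section \<open>Cocycles\<close>

definition remove_arcs :: "('v, 'a) pre_digraph \<Rightarrow> 'a set \<Rightarrow> ('v, 'a) pre_digraph" where
  "remove_arcs D S = D\<lparr>arcs := arcs D - S\<rparr>"

definition weak_components :: "('v, 'a) pre_digraph \<Rightarrow> ('v, 'a) pre_digraph set" where
  "weak_components D =
     {H. verts H \<noteq> {} \<and> pre_digraph.max_subgraph D weakly_connected H}"

definition component_digraph ::
    "('v, 'a) pre_digraph \<Rightarrow> 'a set \<Rightarrow>
     (('v, 'a) pre_digraph, ('v, 'a) pre_digraph \<times> ('v, 'a) pre_digraph) pre_digraph" where
  "component_digraph D S =
     \<lparr>verts = weak_components (remove_arcs D S),
      arcs = {(H, K). H \<in> weak_components (remove_arcs D S) \<and>
                      K \<in> weak_components (remove_arcs D S) \<and> H \<noteq> K \<and>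
                      (\<exists>a \<in> S. tail D a \<in> verts H \<and> head D a \<in> verts K)},
      tail = fst,
      head = snd\<rparr>"

definition strict_cutset :: "('v, 'a) pre_digraph \<Rightarrow> 'a set \<Rightarrow> bool" where
  "strict_cutset D S \<longleftrightarrow>
     S \<subseteq> inner_arcs D \<and>
     card (weak_components (remove_arcs D S)) \<ge> 2 \<and>
     (\<forall>a \<in> S. \<exists>H \<in> weak_components (remove_arcs D S). \<exists>K \<in> weak_components (remove_arcs D S).
        H \<noteq> K \<and> tail D a \<in> verts H \<and> head D a \<in> verts K) \<and>
     acyclic_digraph (component_digraph D S)"

definition cocycle :: "('v, 'a) pre_digraph \<Rightarrow> 'a set \<Rightarrow> bool" where
  "cocycle D C \<longleftrightarrow> strict_cutset D C \<and> card (weak_components (remove_arcs D C)) = 2"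

text \<open>
  The two graphs obtained by cutting depend on the choice of the new vertices \<open>\<nu> a\<close>, one for each
  edge \<open>a\<close> of the cocycle; the third argument is the component on the respective side.
\<close>

definition cut_W ::
    "('v, 'a) pre_digraph \<Rightarrow> 'a set \<Rightarrow> ('v, 'a) pre_digraph \<Rightarrow> ('a \<Rightarrow> 'v) \<Rightarrow> ('v, 'a) pre_digraph"
  where
  "cut_W D C D1 \<nu> =
     \<lparr>verts = verts D1 \<union> \<nu> ` C, arcs = arcs D1 \<union> C,
      tail = tail D, head = (\<lambda>a. if a \<in> C then \<nu> a else head D a)\<rparr>"

definition cut_E ::
    "('v, 'a) pre_digraph \<Rightarrow> 'a set \<Rightarrow> ('v, 'a) pre_digraph \<Rightarrow> ('a \<Rightarrow> 'v) \<Rightarrow> ('v, 'a) pre_digraph"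
  where
  "cut_E D C D2 \<nu> =
     \<lparr>verts = verts D2 \<union> \<nu> ` C, arcs = arcs D2 \<union> C,
      tail = (\<lambda>a. if a \<in> C then \<nu> a else tail D a), head = head D\<rparr>"

text \<open>
  New vertices exist for every cocycle only if the vertex type is large enough, and otherwise the
  quantification over \<open>\<nu>\<close> is vacuous; hence the sort constraint.
\<close>

definition P3_graph :: "('v::infinite, 'a) pre_digraph \<Rightarrow> bool" where
  "P3_graph D \<longleftrightarrow> D_graph D \<and>
     (\<forall>C D1 D2 \<nu>.
        cocycle D C \<and>
        D1 \<in> weak_components (remove_arcs D C) \<and> D2 \<in> weak_components (remove_arcs D C) \<and>
        (\<forall>a \<in> C. tail D a \<in> verts D1 \<and> head D a \<in> verts D2) \<and>
        inj_on \<nu> C \<and> \<nu> ` C \<inter> verts D = {} \<longrightarrow>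
        P_compatible (cut_W D C D1 \<nu>) (cut_E D C D2 \<nu>))"

end

theory Submission
  imports Defs
begin

text \<open>
  By induction on the number of inner vertices. A D-graph with at least two inner vertices has a
  cocycle: take an inner vertex \<open>x\<close> without inner predecessors and a connected component \<open>Q\<close> of the
  remaining inner vertices; all inner edges between \<open>Q\<close> and its complement start in \<open>x\<close>. Cutting through
  it gives P-compatible graphs, so it remains to see that cutting a P'''-graph through a cocycle
  gives P'''-graphs again. Let the inner vertices be split into \<open>V\<close> and \<open>V'\<close>, with edges from
  \<open>V\<close> to \<open>V'\<close>, and \<open>V\<close> further into \<open>K\<close> and \<open>K'\<close>. If there is an edge between \<open>K'\<close> and \<open>V'\<close>, the
  cocycle between \<open>K\<close> and \<open>K' \<union> V'\<close> yields the lists wanted for \<open>K\<close> and \<open>K'\<close>. Otherwise the cocycle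
  between \<open>K \<union> V'\<close> and \<open>K'\<close> yields a list in which the edges from \<open>K\<close> to \<open>V'\<close> are contracted to a point,
  the cocycle between \<open>V\<close> and \<open>V'\<close> yields an order of these edges, and one of the two orientations of
  this order fits into the list.
\<close>

section \<open>Compatible lists\<close>

text \<open>Heredity is not proved for \<open>P3_graph\<close> itself: a cut graph has new vertices,
  and its cocycles and semipaths would have to be compared with those of \<open>D\<close> after
  every cut. Instead everything is phrased inside the fixed graph \<open>D\<close>, with a set of
  inner vertices for each graph obtained by cutting and with arcs in place of boundary vertices; the
  translation is made once for the cocycles of \<open>D\<close> and once for each juncture. The
  difficulty lies in the case without edges between \<open>K'\<close> and \<open>V'\<close>. The
  arcs from \<open>K\<close> to \<open>V'\<close> are internal to \<open>K \<union> V'\<close>, so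
  the list for \<open>K \<union> V'\<close> says nothing about their mutual order; the list for
  \<open>V\<close> orders them, but lacks the arcs from \<open>K\<close> to \<open>K'\<close>.
  Neither list contains all boundary arcs of \<open>K\<close>. What allows merging the two is an
  exchange property of crossings with respect to a fourth arc (\<open>crossing_fourth\<close>). Only
  the half \<open>V\<close> is treated; sides are a parameter so that exchanging them gives the
  result for \<open>V'\<close>.\<close>

lemma compatible_listsI:
  assumes "xs = A @ E @ C" "ys = B @ E @ D" "E \<noteq> []" "distinct (A @ B @ C @ D @ E)"
    "A = [] \<or> B = []" "C = [] \<or> D = []"
  shows "compatible_lists xs ys"
  using assms unfolding compatible_lists_def by blast

lemma compatible_listsE:
  assumes "compatible_lists xs ys"
  obtains A B C D E where "xs = A @ E @ C" "ys = B @ E @ D" "E \<noteq> []"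
    "distinct (A @ B @ C @ D @ E)" "A = [] \<or> B = []" "C = [] \<or> D = []"
  using assms unfolding compatible_lists_def by blast

lemma compatible_lists_commute:
  assumes "compatible_lists xs ys" shows "compatible_lists ys xs"
proof -
  from assms obtain A B C D E where "xs = A @ E @ C" "ys = B @ E @ D" "E \<noteq> []"
    "distinct (A @ B @ C @ D @ E)" "A = [] \<or> B = []" "C = [] \<or> D = []"
    by (rule compatible_listsE)
  then show ?thesis
    by (intro compatible_listsI[of _ B E D _ A C]) auto
qed

lemma compatible_lists_rev:
  assumes "compatible_lists xs ys" shows "compatible_lists (rev xs) (rev ys)"
proof -
  from assms obtain A B C D E where "xs = A @ E @ C" "ys = B @ E @ D" "E \<noteq> []"
    "distinct (A @ B @ C @ D @ E)" "A = [] \<or> B = []" "C = [] \<or> D = []"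
    by (rule compatible_listsE)
  then show ?thesis
    by (intro compatible_listsI[of _ "rev C" "rev E" "rev A" _ "rev D" "rev B"]) auto
qed

text \<open>If the deleted head belongs to the common block, it joins the private prefix of
  \<open>xs\<close>, which is allowed because \<open>ys\<close> then has no private prefix. A
  remaining common element keeps the block nonempty.\<close>

lemma compatible_lists_tl:
  assumes "compatible_lists xs (y # ys)" "set xs \<inter> set ys \<noteq> {}"
  shows "compatible_lists xs ys"
proof -
  obtain A B C D E where d: "xs = A @ E @ C" "y # ys = B @ E @ D" "E \<noteq> []"
    "distinct (A @ B @ C @ D @ E)" "A = [] \<or> B = []" "C = [] \<or> D = []"
    using assms(1) by (rule compatible_listsE)
  show ?thesis
  proof (cases B)
    case Nil
    then obtain E' where E: "E = y # E'" "ys = E' @ D" using d by (cases E) auto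
    have "E' \<noteq> []" using assms(2) E d by auto
    then show ?thesis
      using d E Nil by (intro compatible_listsI[of _ "A @ [y]" E' C _ "[]" D]) auto
  next
    case (Cons z B')
    then show ?thesis
      using d by (intro compatible_listsI[of _ A E C _ B' D]) auto
  qed
qed

lemma compatible_lists_drop_prefix:
  "compatible_lists xs (ps @ ys) \<Longrightarrow> set xs \<inter> set ys \<noteq> {} \<Longrightarrow> compatible_lists xs ys"
proof (induction ps)
  case (Cons p ps)
  then show ?case using compatible_lists_tl[of xs p "ps @ ys"] by auto
qed auto

lemma compatible_lists_infix:
  assumes "compatible_lists xs (ps @ ys @ qs)" "set xs \<inter> set ys \<noteq> {}"
  shows "compatible_lists xs ys"
proof -
  have "compatible_lists xs (ys @ qs)"
    using compatible_lists_drop_prefix[OF assms(1)] assms(2) by auto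
  then have "compatible_lists (rev xs) (rev qs @ rev ys)"
    using compatible_lists_rev by fastforce
  then have "compatible_lists (rev xs) (rev ys)"
    using compatible_lists_drop_prefix assms(2) by fastforce
  then show ?thesis using compatible_lists_rev by fastforce
qed

lemma concat_map_singletons: "(\<And>x. x \<in> set xs \<Longrightarrow> g x = [x]) \<Longrightarrow> concat (map g xs) = xs"
  by (induction xs) auto

text \<open>Outside the common block, elements may be replaced by whole lists or deleted: an empty
  outer part stays empty under \<open>concat (map g _)\<close>, so the conditions on the outer parts
  survive.\<close>

lemma compatible_lists_concat_map:
  assumes c: "compatible_lists xs ys" and g: "\<And>x. x \<in> set xs \<inter> set ys \<Longrightarrow> g x = [x]"
    and dis: "distinct (concat (map g xs))"
    and dj: "\<And>x. x \<in> set xs - set ys \<Longrightarrow> set (g x) \<inter> set ys = {}"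
  shows "compatible_lists (concat (map g xs)) ys"
proof -
  obtain A B C D E where d: "xs = A @ E @ C" "ys = B @ E @ D" "E \<noteq> []"
    "distinct (A @ B @ C @ D @ E)" "A = [] \<or> B = []" "C = [] \<or> D = []"
    using c by (rule compatible_listsE)
  have E: "concat (map g E) = E" using g d by (intro concat_map_singletons) auto
  have "set (concat (map g A)) \<inter> set ys = {}" "set (concat (map g C)) \<inter> set ys = {}"
    using dj d by (simp; blast)+
  then have "distinct (concat (map g A) @ B @ concat (map g C) @ D @ E)"
    using d dis E by (auto simp: Int_commute)
  then show ?thesis
    using d E by (intro compatible_listsI[of _ "concat (map g A)" E "concat (map g C)" _ B D]) auto
qed

lemma compatible_lists_map:
  assumes c: "compatible_lists xs ys" and i: "inj_on h (set xs \<union> set ys)"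
  shows "compatible_lists (map h xs) (map h ys)"
proof -
  obtain A B C D E where d: "xs = A @ E @ C" "ys = B @ E @ D" "E \<noteq> []"
    "distinct (A @ B @ C @ D @ E)" "A = [] \<or> B = []" "C = [] \<or> D = []"
    using c by (rule compatible_listsE)
  have "distinct (map h (A @ B @ C @ D @ E))"
    unfolding distinct_map using d i by (auto intro: inj_on_subset)
  then show ?thesis
    using d by (intro compatible_listsI[of _ "map h A" "map h E" "map h C" _ "map h B" "map h D"]) auto
qed

lemma compatible_lists_split:
  assumes "compatible_lists xs ys"
  obtains ps ms qs where "xs = ps @ ms @ qs" "set ms = set xs \<inter> set ys" "distinct xs"
proof -
  obtain A B C D E where d: "xs = A @ E @ C" "ys = B @ E @ D" "E \<noteq> []"
    "distinct (A @ B @ C @ D @ E)"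
    using assms by (rule compatible_listsE)
  have "set E = set xs \<inter> set ys" unfolding d(1,2) using d(4) by auto
  moreover have "distinct xs" unfolding d(1) using d(4) by auto
  ultimately show thesis using that d(1) by blast
qed

section \<open>Positions in lists and betweenness\<close>

lemma sorted_wrt_rank:
  assumes "distinct xs"
  obtains p :: "'b \<Rightarrow> int" where "sorted_wrt (\<lambda>x y. p x < p y) xs"
proof -
  have "\<exists>p :: 'b \<Rightarrow> int. sorted_wrt (\<lambda>x y. p x < p y) xs" using assms
  proof (induction xs)
    case (Cons x xs)
    then obtain p :: "'b \<Rightarrow> int" where p: "sorted_wrt (\<lambda>x y. p x < p y) xs" by auto
    \<comment> \<open>Inserting \<open>0\<close> makes the argument of \<open>Min\<close> nonempty
      even for \<open>xs = []\<close>; one less than this minimum is below all ranks in use.\<close>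
    define q where "q = p(x := Min (insert 0 (p ` set xs)) - 1)"
    have "q x < q y" if "y \<in> set xs" for y
    proof -
      have "Min (insert 0 (p ` set xs)) \<le> p y" using that by (intro Min_le) auto
      then have "Min (insert 0 (p ` set xs)) - 1 < p y" by linarith
      then show ?thesis using that Cons.prems unfolding q_def by auto
    qed
    moreover have "sorted_wrt (\<lambda>x y. q x < q y) xs"
      using p Cons.prems by (auto simp: q_def intro!: sorted_wrt_mono_rel[OF _ p])
    ultimately show ?case by auto
  qed auto
  then show thesis using that by blast
qed

lemma sorted_wrt_subseq:
  assumes "subseq xs ys" "sorted_wrt R ys" shows "sorted_wrt R xs"
  using assms
proof (induction rule: list_emb.induct)
  case (list_emb_Cons2 x y xs ys)
  then show ?case by (auto dest: list_emb_set)
qed auto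

lemma sorted_rank_subseq:
  fixes p :: "'b \<Rightarrow> int"
  assumes "sorted_wrt (\<lambda>x y. p x < p y) xs" "sorted_wrt (\<lambda>x y. p x < p y) ys" "set ys \<subseteq> set xs"
  shows "subseq ys xs"
  using assms
proof (induction xs arbitrary: ys)
  case (Cons x xs)
  show ?case
  proof (cases ys)
    case (Cons y ys')
    show ?thesis
    proof (cases "x = y")
      case True
      then have "set ys' \<subseteq> set xs" using Cons.prems Cons by auto
      then show ?thesis using Cons.IH[of ys'] Cons.prems Cons True by auto
    next
      case False
      then have "x \<notin> set ys" using Cons.prems Cons by (fastforce)
      then have "subseq ys xs" using Cons.IH[of ys] Cons.prems by auto
      then show ?thesis by auto
    qed
  qed auto
qed auto

lemma in_between_rank:
  fixes p :: "'b \<Rightarrow> int"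
  assumes "sorted_wrt (\<lambda>x y. p x < p y) xs" "x \<in> set xs" "y \<in> set xs" "z \<in> set xs"
    "p x < p y \<and> p y < p z \<or> p z < p y \<and> p y < p x"
  shows "in_between xs x y z"
proof -
  consider "p x < p y \<and> p y < p z" | "p z < p y \<and> p y < p x" using assms by auto
  then show ?thesis
  proof cases
    case 1
    then have "subseq [x, y, z] xs" using assms by (intro sorted_rank_subseq[of p]) auto
    then show ?thesis using 1 by (auto simp: in_between_def)
  next
    case 2
    then have "subseq [z, y, x] xs" using assms by (intro sorted_rank_subseq[of p]) auto
    then show ?thesis using 2 by (auto simp: in_between_def)
  qed
qed

lemma in_between_sorted_wrt:
  assumes "in_between xs x y z" "sorted_wrt R xs"
  shows "R x y \<and> R x z \<and> R y z \<or> R z y \<and> R z x \<and> R y x"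
  using assms sorted_wrt_subseq[OF _ assms(2)] unfolding in_between_def by fastforce

lemma in_between_set:
  assumes "in_between xs x y z" shows "x \<in> set xs" "y \<in> set xs" "z \<in> set xs"
  using assms list_emb_set[of "(=)" "[x, y, z]" xs] list_emb_set[of "(=)" "[z, y, x]" xs]
  unfolding in_between_def by auto

lemma in_between_map:
  assumes "inj_on f (set xs)" "in_between xs x y z"
  shows "in_between (map f xs) (f x) (f y) (f z)"
proof -
  note s = in_between_set[OF assms(2)]
  have "distinct [f x, f y, f z]" using s assms by (auto simp: in_between_def dest: inj_onD)
  moreover have "subseq [f x, f y, f z] (map f xs) \<or> subseq [f z, f y, f x] (map f xs)"
    using assms(2) subseq_map[of "[x,y,z]" xs f] subseq_map[of "[z,y,x]" xs f]
    unfolding in_between_def by auto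
  ultimately show ?thesis unfolding in_between_def by blast
qed

lemma in_between_map_iff:
  assumes "inj_on f (set xs)" "x \<in> set xs" "y \<in> set xs" "z \<in> set xs"
  shows "in_between (map f xs) (f x) (f y) (f z) \<longleftrightarrow> in_between xs x y z"
proof
  let ?g = "inv_into (set xs) f"
  assume "in_between (map f xs) (f x) (f y) (f z)"
  then have "in_between (map ?g (map f xs)) (?g (f x)) (?g (f y)) (?g (f z))"
    by (rule in_between_map[rotated]) (simp add: inj_on_inv_into)
  moreover have "map ?g (map f xs) = xs"
    using assms(1) by (auto intro!: map_idI)
  ultimately show "in_between xs x y z" using assms by simp
next
  assume "in_between xs x y z"
  then show "in_between (map f xs) (f x) (f y) (f z)" by (rule in_between_map[OF assms(1)])
qed

lemma in_between_subseq: "in_between xs x y z \<Longrightarrow> subseq xs ys \<Longrightarrow> in_between ys x y z"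
  unfolding in_between_def using subseq_order.order_trans by blast

text \<open>Turns convexity with respect to betweenness into contiguity, the kind of restriction
  that preserves compatibility (\<open>compatible_lists_infix\<close>).\<close>

lemma filter_infix:
  assumes "distinct xs" "\<And>u a w. in_between xs u a w \<Longrightarrow> u \<in> S \<Longrightarrow> w \<in> S \<Longrightarrow> a \<in> S"
  obtains ps qs where "xs = ps @ filter (\<lambda>x. x \<in> S) xs @ qs"
proof -
  have "\<exists>ps qs. xs = ps @ filter (\<lambda>x. x \<in> S) xs @ qs" using assms
  proof (induction xs)
    case (Cons x xs)
    have "\<exists>ps qs. xs = ps @ filter (\<lambda>x. x \<in> S) xs @ qs"
    proof (rule Cons.IH)
      show "a \<in> S" if "in_between xs u a w" "u \<in> S" "w \<in> S" for u a w
        using Cons.prems(2)[OF in_between_subseq[OF that(1)]] that by auto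
    qed (use Cons.prems in auto)
    then obtain ps qs where e: "xs = ps @ filter (\<lambda>x. x \<in> S) xs @ qs" by blast
    show ?case
    proof (cases "x \<in> S \<and> filter (\<lambda>x. x \<in> S) xs \<noteq> []")
      case False
      show ?thesis
      proof (cases "x \<in> S")
        case True
        then show ?thesis using False by (intro exI[of _ "[]"] exI[of _ xs]) auto
      next
        case False
        then show ?thesis using e by (intro exI[of _ "x # ps"] exI[of _ qs]) auto
      qed
    next
      case True
      then obtain w ws where w: "filter (\<lambda>x. x \<in> S) xs = w # ws" by (cases "filter (\<lambda>x. x \<in> S) xs") auto
      have "w \<in> S" using w filter_eq_ConsD by fastforce
      \<comment> \<open>The last element \<open>a\<close> of a nonempty \<open>ps\<close> would lie
        between \<open>x\<close> and \<open>w\<close>, hence in \<open>S\<close>, and so would occur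
        in the filtered block as well, against distinctness.\<close>
      have "ps = []"
      proof (rule ccontr)
        assume "ps \<noteq> []"
        then obtain a as where a: "ps = as @ [a]" by (metis rev_exhaust)
        have xs: "xs = as @ a # w # ws @ qs" using e w a by simp
        have "subseq [x, a, w] (x # xs)" unfolding xs by auto
        then have "in_between (x # xs) x a w"
          using Cons.prems(1) xs unfolding in_between_def by auto
        then have aS: "a \<in> S" using Cons.prems(2) True \<open>w \<in> S\<close> by blast
        have "distinct (ps @ filter (\<lambda>x. x \<in> S) xs @ qs)" using e Cons.prems(1) by simp
        then have "a \<notin> set (filter (\<lambda>x. x \<in> S) xs)" using a by auto
        then show False using aS xs by auto
      qed
      then show ?thesis using True e by (intro exI[of _ "[]"] exI[of _ qs]) auto
    qed
  qed auto
  then show thesis using that by blast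
qed

section \<open>Connected sets and crossings\<close>

lemma opp_opp [simp]: "opp (opp X) = X"
  by (cases X) auto

definition linked :: "('v, 'a) pre_digraph \<Rightarrow> 'v set \<Rightarrow> 'v set \<Rightarrow> bool" where
  "linked D S T \<longleftrightarrow> (\<exists>a \<in> arcs D. \<exists>X. endp X D a \<in> S \<and> endp (opp X) D a \<in> T)"

text \<open>Connectedness of the subgraph induced on \<open>S\<close>, by cuts instead of semipaths:
  unions, extensions and transfer between graphs then require no surgery on paths.\<close>

definition conn :: "('v, 'a) pre_digraph \<Rightarrow> 'v set \<Rightarrow> bool" where
  "conn D S \<longleftrightarrow> (\<forall>T \<subseteq> S. T \<noteq> {} \<and> T \<noteq> S \<longrightarrow> linked D T (S - T))"

text \<open>In the piece with inner vertices \<open>U\<close> these are the \<open>X\<close>-edges: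
  the \<open>X\<close> end sticks out, the other end is the anchor in \<open>U\<close>.\<close>

definition bnd :: "side \<Rightarrow> ('v, 'a) pre_digraph \<Rightarrow> 'v set \<Rightarrow> 'a set" where
  "bnd X D U = {a \<in> arcs D. endp (opp X) D a \<in> U \<and> endp X D a \<notin> U}"

text \<open>
  A boundary vertex of a piece lies on exactly one arc, so boundary vertices are represented by their
  arcs; this makes the grounding conditions independent of the choice of new vertices in a cut.
  A pair of disjoint semipaths inside \<open>U\<close> extends to a partition of \<open>U\<close> into two connected sets,
  hence \<open>crossing X D U a b c\<close> is the negation of \<open>\<psi>\<^sub>X(a, b, c)\<close> for the piece at \<open>U\<close>.
\<close>

definition crossing ::
    "side \<Rightarrow> ('v, 'a) pre_digraph \<Rightarrow> 'v set \<Rightarrow> 'a \<Rightarrow> 'a \<Rightarrow> 'a \<Rightarrow> bool" where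
  "crossing X D U a b c \<longleftrightarrow>
     (\<exists>P Q. P \<union> Q = U \<and> P \<inter> Q = {} \<and> conn D P \<and> conn D Q \<and>
        endp (opp X) D a \<in> P \<and> endp (opp X) D c \<in> P \<and> endp (opp X) D b \<in> Q \<and>
        (\<exists>d \<in> bnd (opp X) D U. endp X D d \<in> Q))"

definition arc_grounded :: "side \<Rightarrow> ('v, 'a) pre_digraph \<Rightarrow> 'v set \<Rightarrow> 'a list \<Rightarrow> bool" where
  "arc_grounded X D U as \<longleftrightarrow> distinct as \<and> set as = bnd X D U \<and>
     (\<forall>a b c. in_between as a b c \<longrightarrow> \<not> crossing X D U a b c)"

text \<open>A cocycle seen on the inner vertices: every arc between the two connected halves has its
  \<open>X\<close> end in \<open>V'\<close>.\<close>

definition splitting :: "side \<Rightarrow> ('v, 'a) pre_digraph \<Rightarrow> 'v set \<Rightarrow> 'v set \<Rightarrow> 'v set \<Rightarrow> bool" where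
  "splitting X D U V V' \<longleftrightarrow> V \<union> V' = U \<and> V \<inter> V' = {} \<and> V \<noteq> {} \<and> V' \<noteq> {} \<and> conn D V \<and> conn D V' \<and>
     (\<forall>a \<in> arcs D. endp (opp X) D a \<in> V' \<longrightarrow> endp X D a \<notin> V)"

definition arc_compatible :: "side \<Rightarrow> ('v, 'a) pre_digraph \<Rightarrow> 'v set \<Rightarrow> 'v set \<Rightarrow> bool" where
  "arc_compatible X D V V' \<longleftrightarrow>
     (\<exists>xs ys. arc_grounded X D V xs \<and> arc_grounded (opp X) D V' ys \<and> compatible_lists xs ys)"

text \<open>The hereditary form of P''': it depends on \<open>D\<close> and \<open>U\<close> only,
  not on how the piece at \<open>U\<close> was cut out.\<close>

definition all_splittings_compatible :: "('v, 'a) pre_digraph \<Rightarrow> 'v set \<Rightarrow> bool" where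
  "all_splittings_compatible D U \<longleftrightarrow>
     (\<forall>X V V'. splitting X D U V V' \<longrightarrow> arc_compatible X D V V')"

lemma linked_commute: "linked D S T \<longleftrightarrow> linked D T S"
  unfolding linked_def by (metis opp_opp)

lemma linked_mono: "linked D S T \<Longrightarrow> S \<subseteq> S' \<Longrightarrow> T \<subseteq> T' \<Longrightarrow> linked D S' T'"
  unfolding linked_def by blast

lemma linked_Un: "linked D S (T \<union> T') \<longleftrightarrow> linked D S T \<or> linked D S T'"
  unfolding linked_def by blast

lemma linkedI: "a \<in> arcs D \<Longrightarrow> endp X D a \<in> S \<Longrightarrow> endp (opp X) D a \<in> T \<Longrightarrow> linked D S T"
  unfolding linked_def by blast

lemma linked_side:
  assumes "linked D S T"
  obtains a where "a \<in> arcs D" "endp X D a \<in> S" "endp (opp X) D a \<in> T"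
  | a where "a \<in> arcs D" "endp X D a \<in> T" "endp (opp X) D a \<in> S"
  using assms unfolding linked_def
  by (metis (full_types) opp.simps side.exhaust)

lemma connD: "conn D S \<Longrightarrow> T \<subseteq> S \<Longrightarrow> T \<noteq> {} \<Longrightarrow> T \<noteq> S \<Longrightarrow> linked D T (S - T)"
  unfolding conn_def by blast

lemma conn_singleton [simp]: "conn D {x}"
  unfolding conn_def by auto

lemma conn_Un:
  assumes S: "conn D S" and T: "conn D T" and l: "linked D S T \<or> S \<inter> T \<noteq> {}"
  shows "conn D (S \<union> T)"
  unfolding conn_def
proof (intro allI impI)
  fix X assume X: "X \<subseteq> S \<union> T" "X \<noteq> {} \<and> X \<noteq> S \<union> T"
  consider "X \<inter> S \<noteq> {} \<and> X \<inter> S \<noteq> S" | "X \<inter> T \<noteq> {} \<and> X \<inter> T \<noteq> T"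
    | "X \<inter> S = S" "X \<inter> T = {}" | "X \<inter> S = {}" "X \<inter> T = T"
    using X by blast
  then show "linked D X (S \<union> T - X)"
  proof cases
    case 1
    then have "linked D (X \<inter> S) (S - X \<inter> S)" using connD[OF S] by blast
    then show ?thesis by (rule linked_mono) auto
  next
    case 2
    then have "linked D (X \<inter> T) (T - X \<inter> T)" using connD[OF T] by blast
    then show ?thesis by (rule linked_mono) auto
  next
    case 3
    then have "linked D S T" using l by blast
    then show ?thesis using 3 by (rule_tac linked_mono) auto
  next
    case 4
    then have "linked D T S" using l linked_commute by blast
    then show ?thesis using 4 by (rule_tac linked_mono) auto
  qed
qed

lemma conn_insert: "conn D S \<Longrightarrow> linked D S {x} \<Longrightarrow> conn D (insert x S)"
  using conn_Un[of D S "{x}"] by simp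

lemma linked_singleton:
  assumes "linked D S T" obtains x where "x \<in> T" "linked D S {x}"
  using assms unfolding linked_def by blast

text \<open>As long as vertices of \<open>U\<close> remain, connectedness of \<open>U\<close> links
  one of them to \<open>P\<close> or to \<open>Q\<close>, and that set takes it in.\<close>

lemma conn_extend:
  assumes U: "finite U" "conn D U"
    and P: "conn D P" "P \<subseteq> U" "P \<noteq> {}" and Q: "conn D Q" "Q \<subseteq> U" "Q \<noteq> {}" and dj: "P \<inter> Q = {}"
  obtains P' Q' where "P \<subseteq> P'" "Q \<subseteq> Q'" "P' \<union> Q' = U" "P' \<inter> Q' = {}" "conn D P'" "conn D Q'"
proof -
  have "\<exists>P' Q'. P \<subseteq> P' \<and> Q \<subseteq> Q' \<and> P' \<union> Q' = U \<and> P' \<inter> Q' = {} \<and> conn D P' \<and> conn D Q'"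
    using P Q dj
  proof (induction "card (U - (P \<union> Q))" arbitrary: P Q rule: less_induct)
    case less
    show ?case
    proof (cases "P \<union> Q = U")
      case True
      then show ?thesis using less.prems by blast
    next
      case False
      then have "linked D (P \<union> Q) (U - (P \<union> Q))" using less.prems by (intro connD[OF U(2)]) auto
      then obtain x where x: "x \<in> U - (P \<union> Q)" "linked D (P \<union> Q) {x}" by (rule linked_singleton)
      have c: "card (U - insert x (P \<union> Q)) < card (U - (P \<union> Q))"
        using x U(1) by (intro psubset_card_mono) auto
      from x(2) have "linked D P {x} \<or> linked D Q {x}"
        using linked_Un linked_commute by metis
      then show ?thesis
      proof
        assume "linked D P {x}"
        then show ?thesis
          using less.hyps[of "insert x P" Q] c x(1) less.prems conn_insert[of D P x] by auto
      next
        assume "linked D Q {x}"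
        then show ?thesis
          using less.hyps[of P "insert x Q"] c x(1) less.prems conn_insert[of D Q x] by auto
      qed
    qed
  qed
  then show thesis using that by blast
qed

text \<open>Growing \<open>P\<close> and \<open>Q\<close> by \<open>conn_extend\<close> yields the
  partition of \<open>U\<close> that a crossing asks for, so witnesses may be given locally.\<close>

lemma crossingI:
  assumes U: "finite U" "conn D U"
    and P: "conn D P" "P \<subseteq> U" and Q: "conn D Q" "Q \<subseteq> U" and dj: "P \<inter> Q = {}"
    and abc: "endp (opp X) D a \<in> P" "endp (opp X) D c \<in> P" "endp (opp X) D b \<in> Q"
    and d: "d \<in> bnd (opp X) D U" "endp X D d \<in> Q"
  shows "crossing X D U a b c"
proof -
  obtain P' Q' where "P \<subseteq> P'" "Q \<subseteq> Q'" "P' \<union> Q' = U" "P' \<inter> Q' = {}" "conn D P'" "conn D Q'"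
    using conn_extend[OF U P _ Q _ dj] abc by blast
  then show ?thesis unfolding crossing_def using abc d by blast
qed

section \<open>Symmetry, exchange and transfer of crossings\<close>

lemma crossing_commute: "crossing X D U a b c \<Longrightarrow> crossing X D U c b a"
  unfolding crossing_def by blast

text \<open>The anchor of \<open>d\<close> lies on one of the two sides: in \<open>Q\<close> it can
  replace that of \<open>b\<close>, in \<open>P\<close> it can replace that of \<open>c\<close> as
  well as that of \<open>a\<close>.\<close>

lemma crossing_fourth:
  assumes "crossing X D U a b c" "endp (opp X) D d \<in> U"
  shows "crossing X D U a d c \<or> crossing X D U a b d \<and> crossing X D U d b c"
proof -
  obtain P Q where PQ: "P \<union> Q = U" "P \<inter> Q = {}" "conn D P" "conn D Q"
    "endp (opp X) D a \<in> P" "endp (opp X) D c \<in> P" "endp (opp X) D b \<in> Q"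
    "\<exists>d \<in> bnd (opp X) D U. endp X D d \<in> Q"
    using assms(1) unfolding crossing_def by blast
  have "endp (opp X) D d \<in> P \<or> endp (opp X) D d \<in> Q" using assms(2) PQ(1) by blast
  then show ?thesis
  proof
    assume d: "endp (opp X) D d \<in> P"
    have "crossing X D U a b d" "crossing X D U d b c"
      unfolding crossing_def by (rule exI[of _ P], rule exI[of _ Q], use PQ d in blast)+
    then show ?thesis by blast
  next
    assume d: "endp (opp X) D d \<in> Q"
    have "crossing X D U a d c"
      unfolding crossing_def by (rule exI[of _ P], rule exI[of _ Q], use PQ d in blast)
    then show ?thesis by blast
  qed
qed

text \<open>\<open>V\<close> is contracted to the arc \<open>f\<close> anchored in it. All arcs into
  \<open>V\<close> have the same image under \<open>r\<close>, so by \<open>ne\<close> they occur on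
  one side of the crossing only; that side takes in \<open>V\<close>, and if there are none,
  \<open>crossingI\<close> distributes \<open>V\<close>. The exit \<open>d\<close> of
  \<open>Q\<close> remains a boundary arc because \<open>no\<close> forbids it to meet
  \<open>V\<close>.\<close>

lemma crossing_absorb:
  assumes fin: "finite (K \<union> V)" and K: "conn D K" and V: "conn D V" "K \<inter> V = {}" "linked D K V"
    and no: "\<And>a. a \<in> arcs D \<Longrightarrow> endp (opp X) D a \<in> V \<Longrightarrow> endp X D a \<notin> K"
    and f: "endp (opp X) D f \<in> V"
    and cr: "crossing X D K x y z"
    and r: "\<And>a. r a = (if endp X D a \<in> V then f else a)"
    and ne: "r x \<noteq> r y" "r z \<noteq> r y"
    and xyz: "x \<in> arcs D" "y \<in> arcs D" "z \<in> arcs D"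
  shows "crossing X D (K \<union> V) (r x) (r y) (r z)"
proof -
  obtain P Q d where PQ: "P \<union> Q = K" "P \<inter> Q = {}" "conn D P" "conn D Q"
    "endp (opp X) D x \<in> P" "endp (opp X) D z \<in> P" "endp (opp X) D y \<in> Q"
    and d: "d \<in> bnd (opp X) D K" "endp X D d \<in> Q"
    using cr unfolding crossing_def by blast
  have d': "d \<in> bnd (opp X) D (K \<union> V)" using d no unfolding bnd_def by auto
  have KV: "conn D (K \<union> V)" using conn_Un[OF K V(1)] V by blast
  show ?thesis
  proof (cases "endp X D y \<in> V")
    case True
    then have l: "linked D V Q" using PQ xyz by (intro linkedI[of y D X]) auto
    have "r x = x" "r z = z" "r y = f" using ne r True by auto
    moreover have "conn D (V \<union> Q)" using conn_Un[OF V(1) PQ(4)] l by blast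
    ultimately show ?thesis
      using PQ V f d d' by (intro crossingI[OF fin KV, of P "V \<union> Q" X _ _ _ d]) auto
  next
    case yV: False
    show ?thesis
    proof (cases "endp X D x \<in> V \<or> endp X D z \<in> V")
      case True
      then have l: "linked D V P" using PQ xyz
        by (metis linkedI)
      have "conn D (V \<union> P)" using conn_Un[OF V(1) PQ(3)] l by blast
      moreover have "r y = y" "endp (opp X) D (r x) \<in> V \<union> P" "endp (opp X) D (r z) \<in> V \<union> P"
        using yV r PQ f by auto
      ultimately show ?thesis
        using PQ V f d d' by (intro crossingI[OF fin KV, of "V \<union> P" Q X _ _ _ d]) auto
    next
      case False
      then have "r x = x" "r z = z" "r y = y" using r yV by auto
      then show ?thesis
        using PQ V f d d' by (intro crossingI[OF fin KV, of P Q X _ _ _ d]) auto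
    qed
  qed
qed

text \<open>The exit of \<open>Q\<close> is lost if it leads into \<open>V\<close>; then
  \<open>Q\<close> takes in \<open>V\<close>, and \<open>f\<close> is an exit of the enlarged set,
  since by \<open>no\<close> it does not lead back into \<open>K\<close>.\<close>

lemma crossing_enlarge:
  assumes fin: "finite (K \<union> V)" and K: "conn D K" and V: "conn D V" "K \<inter> V = {}" "linked D K V"
    and no: "\<And>a. a \<in> arcs D \<Longrightarrow> endp (opp X) D a \<in> V \<Longrightarrow> endp X D a \<notin> K"
    and f: "f \<in> bnd X D V"
    and cr: "crossing (opp X) D K x y z"
  shows "crossing (opp X) D (K \<union> V) x y z"
proof -
  obtain P Q d where PQ: "P \<union> Q = K" "P \<inter> Q = {}" "conn D P" "conn D Q"
    "endp X D x \<in> P" "endp X D z \<in> P" "endp X D y \<in> Q"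
    and d: "d \<in> bnd X D K" "endp (opp X) D d \<in> Q"
    using cr unfolding crossing_def by auto
  have KV: "conn D (K \<union> V)" using conn_Un[OF K V(1)] V by blast
  show ?thesis
  proof (cases "endp X D d \<in> V")
    case True
    then have "linked D V Q" using d by (intro linkedI[of d D X]) (auto simp: bnd_def)
    then have "conn D (V \<union> Q)" using conn_Un[OF V(1) PQ(4)] by blast
    moreover have "f \<in> bnd X D (K \<union> V)" "endp (opp X) D f \<in> V" using f no by (auto simp: bnd_def)
    ultimately show ?thesis
      using PQ V by (intro crossingI[OF fin KV, of P "V \<union> Q" "opp X" _ _ _ f]) auto
  next
    case False
    then have "d \<in> bnd X D (K \<union> V)" using d by (auto simp: bnd_def)
    then show ?thesis
      using PQ V d by (intro crossingI[OF fin KV, of P Q "opp X" _ _ _ d]) auto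
  qed
qed

lemma crossing_pair:
  assumes fin: "finite (K \<union> V)" and K: "conn D K" and V: "conn D V" "K \<inter> V = {}" "linked D K V"
    and no: "\<And>a. a \<in> arcs D \<Longrightarrow> endp (opp X) D a \<in> V \<Longrightarrow> endp X D a \<notin> K"
    and f: "f \<in> bnd X D V"
    and xyz: "endp X D x \<in> K" "endp X D z \<in> K" "endp X D y \<in> V"
  shows "crossing (opp X) D (K \<union> V) x y z"
proof -
  have KV: "conn D (K \<union> V)" using conn_Un[OF K V(1)] V by blast
  moreover have "f \<in> bnd X D (K \<union> V)" "endp (opp X) D f \<in> V" using f no by (auto simp: bnd_def)
  ultimately show ?thesis
    using K V xyz by (intro crossingI[OF fin KV, of K V "opp X" _ _ _ f]) auto
qed

text \<open>
  Here \<open>p\<close> and \<open>q\<close> are positions in two lists: \<open>p\<close> merges all of \<open>A\<close> into the single position \<open>m\<close>, and \<open>q\<close>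
  spreads it out. If \<open>A\<close> could be inserted at \<open>m\<close> neither in the order of \<open>q\<close> nor in the reverse order,
  there would be obstructions \<open>s\<close> and \<open>t\<close>; applying \<open>fourth\<close> to the one farther away from \<open>A\<close> gives a
  crossing that \<open>p\<close> or \<open>q\<close> excludes.
\<close>

lemma orientation_exists:
  fixes p q :: "'a \<Rightarrow> int" and cr :: "'a \<Rightarrow> 'a \<Rightarrow> 'a \<Rightarrow> bool"
  assumes sym: "\<And>x y z. cr x y z \<Longrightarrow> cr z y x"
    and fourth: "\<And>x y z s. cr x y z \<Longrightarrow> s \<in> S \<Longrightarrow> cr x s z \<or> cr x y s \<and> cr s y z"
    and pcr: "\<And>x y z. {x, y, z} \<subseteq> S \<union> A \<Longrightarrow> p x < p y \<Longrightarrow> p y < p z \<Longrightarrow> \<not> cr x y z"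
    and qcr: "\<And>x y z. {x, y, z} \<subseteq> S \<union> A \<Longrightarrow> q x < q y \<Longrightarrow> q y < q z \<Longrightarrow> \<not> cr x y z"
    and pA: "\<And>a. a \<in> A \<Longrightarrow> p a = m" and pS: "\<And>s. s \<in> S \<Longrightarrow> p s \<noteq> m"
    and qS: "\<And>s. s \<in> S \<Longrightarrow> (\<forall>a \<in> A. q s < q a) \<or> (\<forall>a \<in> A. q a < q s)"
    and inj: "\<And>s t. s \<in> S \<Longrightarrow> t \<in> S \<Longrightarrow> s \<noteq> t \<Longrightarrow> p s \<noteq> p t"
    and qinj: "\<And>s t. s \<in> S \<Longrightarrow> t \<in> S \<Longrightarrow> q s = q t \<Longrightarrow> p s < m \<longleftrightarrow> p t < m"
  shows "\<exists>\<epsilon>. (\<epsilon> = 1 \<or> \<epsilon> = -1) \<and> (\<forall>s \<in> S. \<forall>a \<in> A. \<forall>b \<in> A. \<epsilon> * q a < \<epsilon> * q b \<longrightarrow>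
       (p s < m \<longrightarrow> \<not> cr s a b) \<and> (m < p s \<longrightarrow> \<not> cr a b s))"
proof (rule ccontr)
  assume no: "\<not> ?thesis"
  define viol where "viol s a b \<longleftrightarrow> s \<in> S \<and> a \<in> A \<and> b \<in> A \<and> (p s < m \<and> cr s a b \<or> m < p s \<and> cr a b s)" for s a b
  \<comment> \<open>Both orientations fail: \<open>s\<close> obstructs the order of \<open>q\<close>
    on \<open>A\<close>, and \<open>t\<close> below obstructs the reversed one.\<close>
  have "\<exists>s a b. viol s a b \<and> q a < q b" using spec[OF no[unfolded not_ex], of 1] unfolding viol_def by fastforce
  then obtain s a b where 1: "viol s a b" "q a < q b" by blast
  have "\<exists>s a b. viol s a b \<and> q b < q a" using spec[OF no[unfolded not_ex], of "-1"] unfolding viol_def by fastforce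
  then obtain t c d where 2: "viol t c d" "q d < q c" by blast
  have s: "s \<in> S" "a \<in> A" "b \<in> A" and t: "t \<in> S" "c \<in> A" "d \<in> A" using 1 2 unfolding viol_def by auto
  \<comment> \<open>As \<open>q a < q b\<close>, the obstruction would contradict \<open>qcr\<close>
    if \<open>q\<close> had \<open>s\<close> on the same side of \<open>A\<close> as
    \<open>p\<close>; so the sides are opposite.\<close>
  have s_side: "p s < m \<and> (\<forall>a\<in>A. q a < q s) \<or> m < p s \<and> (\<forall>a\<in>A. q s < q a)"
    using 1 qS[of s] qcr[of s a b] qcr[of a b s] unfolding viol_def by force
  \<comment> \<open>Here \<open>q d < q c\<close>, so the same argument puts \<open>t\<close> on
    equal sides of \<open>A\<close> under \<open>p\<close> and \<open>q\<close>.\<close>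
  have t_side: "p t < m \<and> (\<forall>a\<in>A. q t < q a) \<or> m < p t \<and> (\<forall>a\<in>A. q a < q t)"
    using 2 qS[of t] qcr[of d c t] qcr[of t d c] sym[of c d t] sym[of t c d] unfolding viol_def by force
  have P: "x \<in> S \<Longrightarrow> y \<in> S \<Longrightarrow> z \<in> A \<Longrightarrow>
      (p x < p y \<and> p y < m \<longrightarrow> \<not> cr x y z \<and> \<not> cr z y x) \<and> (m < p y \<and> p y < p x \<longrightarrow> \<not> cr x y z \<and> \<not> cr z y x)
     \<and> (p x < m \<and> m < p y \<longrightarrow> \<not> cr x z y \<and> \<not> cr y z x)" for x y z
    using pcr[of x y z] pcr[of z y x] pcr[of x z y] sym[of x y z] sym[of z y x] sym[of y z x] pA[of z] by auto
  have Q: "x \<in> S \<Longrightarrow> y \<in> S \<Longrightarrow> z \<in> A \<Longrightarrow>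
      (q x < q y \<and> q y < q z \<longrightarrow> \<not> cr x y z \<and> \<not> cr z y x) \<and> (q z < q y \<and> q y < q x \<longrightarrow> \<not> cr x y z \<and> \<not> cr z y x)
     \<and> (q x < q z \<and> q z < q y \<longrightarrow> \<not> cr x z y \<and> \<not> cr y z x)" for x y z
    using qcr[of x y z] qcr[of z y x] qcr[of x z y] sym[of x y z] sym[of z y x] sym[of y z x] by auto
  have F1: "p s < m \<Longrightarrow> cr s t b \<or> cr s a t \<and> cr t a b" "m < p s \<Longrightarrow> cr a t s \<or> cr a b t \<and> cr t b s"
    using fourth[of s a b t] fourth[of a b s t] 1 t unfolding viol_def by auto
  have F2: "p t < m \<Longrightarrow> cr t s d \<or> cr t c s \<and> cr s c d" "m < p t \<Longrightarrow> cr c s t \<or> cr c d s \<and> cr s d t"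
    using fourth[of t c d s] fourth[of c d t s] 2 s unfolding viol_def by auto
  have "s \<noteq> t" using s_side t_side s by force
  then have pn: "p s \<noteq> p t" using inj s t by blast
  \<comment> \<open>If \<open>p\<close> has \<open>s\<close> and \<open>t\<close> on the same side
    of \<open>A\<close>, then \<open>q\<close> has \<open>A\<close> between them, and
    \<open>p\<close> decides which one is farther away. If \<open>p\<close> has \<open>A\<close>
    between them, then \<open>q\<close> has both on one side and decides; \<open>qinj\<close>
    excludes a tie there.\<close>
  from s_side show False
  proof
    assume S: "p s < m \<and> (\<forall>a\<in>A. q a < q s)"
    from t_side show False
    proof
      assume T: "p t < m \<and> (\<forall>a\<in>A. q t < q a)"
      show False
        using S T pn F1(1) F2(1) P[OF s(1) t(1) s(3)] P[OF t(1) s(1) t(3)]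
          Q[OF t(1) s(1) s(2)] Q[OF t(1) s(1) t(2)] s t by (cases "p s < p t") auto
    next
      assume T: "m < p t \<and> (\<forall>a\<in>A. q a < q t)"
      then have "q s \<noteq> q t" using qinj[OF s(1) t(1)] S by auto
      then show False
        using S T F1(1) F2(2) P[OF s(1) t(1) s(2)] P[OF s(1) t(1) t(3)] 
          Q[OF s(1) t(1) s(3)] Q[OF t(1) s(1) t(2)] s t by (cases "q s < q t") auto
    qed
  next
    assume S: "m < p s \<and> (\<forall>a\<in>A. q s < q a)"
    from t_side show False
    proof
      assume T: "p t < m \<and> (\<forall>a\<in>A. q t < q a)"
      then have "q s \<noteq> q t" using qinj[OF s(1) t(1)] S by auto
      then show False
        using S T F1(2) F2(1) P[OF t(1) s(1) s(3)] P[OF t(1) s(1) t(2)] 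
          Q[OF s(1) t(1) s(2)] Q[OF t(1) s(1) t(3)] s t by (cases "q s < q t") auto
    next
      assume T: "m < p t \<and> (\<forall>a\<in>A. q a < q t)"
      show False
        using S T pn F1(2) F2(2) P[OF s(1) t(1) s(2)] P[OF t(1) s(1) t(2)]
          Q[OF s(1) t(1) s(3)] Q[OF s(1) t(1) t(3)] s t by (cases "p s < p t") auto
    qed
  qed
qed

lemma opp_neq [simp]: "opp X \<noteq> X"
  by (cases X) auto

lemma side_cases: "Y = X \<or> Y = opp X"
  by (cases X; cases Y) auto

lemma UNIV_side: "UNIV = {West, East}"
  using side.exhaust by auto

lemma conn_Un_pendant:
  assumes S: "conn D S" and T: "\<And>t. t \<in> T \<Longrightarrow> linked D S {t}"
  shows "conn D (S \<union> T)"
  unfolding conn_def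
proof (intro allI impI)
  fix X assume X: "X \<subseteq> S \<union> T" "X \<noteq> {} \<and> X \<noteq> S \<union> T"
  consider "X \<inter> S \<noteq> {}" "X \<inter> S \<noteq> S" | "S \<subseteq> X" | "X \<inter> S = {}" by blast
  then show "linked D X (S \<union> T - X)"
  proof cases
    case 1
    then have "linked D (X \<inter> S) (S - X \<inter> S)" by (intro connD[OF S]) auto
    then show ?thesis by (rule linked_mono) auto
  next
    case 2
    then obtain t where t: "t \<in> T" "t \<notin> X" using X by blast
    from T[OF t(1)] show ?thesis by (rule linked_mono) (use 2 t in auto)
  next
    case 3
    then obtain t where t: "t \<in> T" "t \<in> X" using X by blast
    have "linked D {t} S" using T[OF t(1)] linked_commute by blast
    then show ?thesis by (rule linked_mono) (use 3 t in auto)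
  qed
qed

lemma conn_remove_pendant:
  assumes S: "conn G S"
    and nbr: "\<And>X Y a b. a \<in> arcs G \<Longrightarrow> b \<in> arcs G \<Longrightarrow> endp X G a \<in> S - U \<Longrightarrow> endp Y G b = endp X G a \<Longrightarrow>
      endp (opp Y) G b = endp (opp X) G a"
  shows "conn G (S \<inter> U)"
  unfolding conn_def
proof (intro allI impI)
  fix T assume T: "T \<subseteq> S \<inter> U" "T \<noteq> {} \<and> T \<noteq> S \<inter> U"
  \<comment> \<open>The pendant vertices attached to \<open>T\<close> are moved to its side. As a
    pendant vertex has only one neighbour, an arc leaving \<open>T'\<close> must start in
    \<open>T\<close> and end in \<open>U\<close>.\<close>
  define T' where "T' = T \<union> {l \<in> S - U. linked G {l} T}"
  have "linked G T' (S - T')" using T by (intro connD[OF S(1)]) (auto simp: T'_def)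
  then obtain a X where a: "a \<in> arcs G" "endp X G a \<in> T'" "endp (opp X) G a \<in> S - T'"
    unfolding linked_def by blast
  have TX: "endp X G a \<in> T"
  proof (rule ccontr)
    assume "endp X G a \<notin> T"
    then have l: "endp X G a \<in> S - U" "linked G {endp X G a} T" using a(2) by (auto simp: T'_def)
    then obtain b Y where b: "b \<in> arcs G" "endp Y G b = endp X G a" "endp (opp Y) G b \<in> T"
      unfolding linked_def by blast
    then have "endp (opp X) G a \<in> T" using nbr[OF a(1) b(1) l(1) b(2)] by simp
    then show False using a(3) by (auto simp: T'_def)
  qed
  have "endp (opp X) G a \<in> U"
  proof (rule ccontr)
    assume n: "endp (opp X) G a \<notin> U"
    have "linked G {endp (opp X) G a} T"
      using a(1) TX by (intro linkedI[of a G "opp X"]) auto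
    then show False using a(3) n by (auto simp: T'_def)
  qed
  then show "linked G T (S \<inter> U - T)"
    using a(1,3) TX by (intro linkedI[of a G X]) (auto simp: T'_def)
qed

section \<open>Splittings of connected sets\<close>

lemma bndD: "a \<in> bnd X D U \<Longrightarrow> a \<in> arcs D \<and> endp (opp X) D a \<in> U \<and> endp X D a \<notin> U"
  by (simp add: bnd_def)

lemma splittingD:
  assumes "splitting X D U V V'"
  shows "V \<union> V' = U" "V \<inter> V' = {}" "V \<noteq> {}" "V' \<noteq> {}" "conn D V" "conn D V'"
    "\<And>a. a \<in> arcs D \<Longrightarrow> endp (opp X) D a \<in> V' \<Longrightarrow> endp X D a \<notin> V"
  using assms unfolding splitting_def by auto

lemma splitting_commute: "splitting X D U V V' \<longleftrightarrow> splitting (opp X) D U V' V"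
  unfolding splitting_def by auto

lemma arc_compatible_commute: "arc_compatible X D V V' \<Longrightarrow> arc_compatible (opp X) D V' V"
  unfolding arc_compatible_def using compatible_lists_commute by fastforce

lemma arc_groundedD:
  assumes "arc_grounded X D U xs"
  shows "distinct xs" "set xs = bnd X D U" "\<And>a b c. in_between xs a b c \<Longrightarrow> \<not> crossing X D U a b c"
  using assms unfolding arc_grounded_def by auto

lemma splitting_linked:
  assumes "splitting X D U V V'" "conn D U" shows "linked D V V'"
proof -
  have "linked D V (U - V)"
    using splittingD[OF assms(1)] by (intro connD[OF assms(2)]) auto
  moreover have "U - V = V'" using splittingD(1,2)[OF assms(1)] by blast
  ultimately show ?thesis by simp
qed

lemma splitting_linked_arc:
  assumes "splitting X D U V V'" "linked D K V'" "K \<subseteq> V"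
  obtains a where "a \<in> arcs D" "endp (opp X) D a \<in> K" "endp X D a \<in> V'"
  using assms(2)
proof (rule linked_side[of D K V' X])
  fix a assume "a \<in> arcs D" "endp X D a \<in> K" "endp (opp X) D a \<in> V'"
  then show thesis using splittingD(7)[OF assms(1)] assms(3) by blast
qed (use that in blast)

text \<open>
  An arc from \<open>V\<close> to \<open>V'\<close> is never between two arcs at \<open>K'\<close>: the sets \<open>K'\<close> and \<open>V'\<close> witness a crossing.
  So the arcs at \<open>K'\<close> form an infix of the list for \<open>K' \<union> V'\<close>.
\<close>

lemma arc_compatible_linked_later:
  assumes fin: "finite U" and U: "conn D U" "all_splittings_compatible D U"
    and s1: "splitting X D U V V'" and s2: "splitting X D V K K'" and l: "linked D K' V'"
    and f: "f \<in> bnd X D V'"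
  shows "arc_compatible X D K K'"
proof -
  note S1 = splittingD[OF s1] and S2 = splittingD[OF s2]
  have no: "endp X D a \<notin> K'" if "a \<in> arcs D" "endp (opp X) D a \<in> V'" for a
    using S1(7)[OF that] S2(1) by blast
  have fin': "finite (K' \<union> V')" by (rule finite_subset[OF _ fin]) (use S1(1) S2(1) in blast)
  have "conn D (K' \<union> V')" using conn_Un[OF S2(6) S1(6)] l by blast
  then have "splitting X D U K (K' \<union> V')"
    unfolding splitting_def using S1 S2 by auto
  then obtain xs ys where xs: "arc_grounded X D K xs" and ys: "arc_grounded (opp X) D (K' \<union> V') ys"
    and c: "compatible_lists xs ys"
    using U(2) unfolding all_splittings_compatible_def arc_compatible_def by blast
  have K'V': "K' \<inter> V' = {}" using S1(2) S2(1) by blast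
  have cr: "crossing (opp X) D (K' \<union> V') x y z"
    if "endp X D x \<in> K'" "endp X D z \<in> K'" "endp X D y \<in> V'" for x y z
    using crossing_pair[OF fin' S2(6) S1(6) K'V' l no f that] .
  have sub: "bnd (opp X) D K' \<subseteq> set ys"
    using arc_groundedD(2)[OF ys] no by (auto simp: bnd_def)
  define zs where "zs = filter (\<lambda>x. x \<in> bnd (opp X) D K') ys"
  obtain ps qs where ys': "ys = ps @ zs @ qs"
  proof (unfold zs_def, rule filter_infix)
    show "distinct ys" by (rule arc_groundedD(1)[OF ys])
    show "a \<in> bnd (opp X) D K'"
      if ib: "in_between ys u a w" and uw: "u \<in> bnd (opp X) D K'" "w \<in> bnd (opp X) D K'" for u a w
    proof (rule ccontr)
      assume na: "a \<notin> bnd (opp X) D K'"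
      have "a \<in> bnd (opp X) D (K' \<union> V')" using in_between_set[OF ib] arc_groundedD(2)[OF ys] by blast
      then have "endp X D a \<in> V'" using na by (auto simp: bnd_def)
      then have "crossing (opp X) D (K' \<union> V') u a w" using cr uw by (auto simp: bnd_def)
      then show False using arc_groundedD(3)[OF ys ib] by blast
    qed
  qed
  have set_zs: "set zs = bnd (opp X) D K'" using sub by (auto simp: zs_def)
  \<comment> \<open>Passing to the infix requires a common element of both lists; an arc from
    \<open>K\<close> to \<open>K'\<close> is one.\<close>
  have "linked D K K'" using splitting_linked[OF s2 S1(5)] .
  then obtain a where "a \<in> arcs D" "endp (opp X) D a \<in> K" "endp X D a \<in> K'"
    using splitting_linked_arc[OF s2] by blast
  then have "a \<in> set xs \<inter> set zs"
    using S2(2) arc_groundedD(2)[OF xs] set_zs by (auto simp: bnd_def)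
  then have "compatible_lists xs zs" using compatible_lists_infix[of xs ps zs qs] c ys' by auto
  moreover have "arc_grounded (opp X) D K' zs"
    unfolding arc_grounded_def
  proof (intro conjI allI impI)
    show "distinct zs" using arc_groundedD(1)[OF ys] by (simp add: zs_def)
    fix a b c assume "in_between zs a b c"
    then have "in_between ys a b c" by (rule in_between_subseq) (simp add: zs_def)
    then show "\<not> crossing (opp X) D K' a b c"
      using arc_groundedD(3)[OF ys] crossing_enlarge[OF fin' S2(6) S1(6) K'V' l no f] by blast
  qed (rule set_zs)
  ultimately show ?thesis using xs unfolding arc_compatible_def by blast
qed

lemma concat_map_filter_singletons:
  "(\<And>x. x \<in> set xs \<Longrightarrow> g x = (if P x then [x] else [])) \<Longrightarrow> concat (map g xs) = filter P xs"
  by (induction xs) auto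

text \<open>
  In a list for \<open>K \<union> V'\<close>, one arc \<open>e\<close> leaving \<open>V'\<close> stands for all arcs from \<open>K\<close> to \<open>V'\<close>; it is replaced
  by these arcs, in the order or the reverse order of a list for \<open>V = K \<union> K'\<close>.
\<close>

lemma arc_compatible_linked_earlier:
  assumes fin: "finite U" and U: "conn D U" "all_splittings_compatible D U"
    and s1: "splitting X D U V V'" and s2: "splitting X D V K K'"
    and nl: "\<not> linked D K' V'" and l: "linked D K V'"
    and e: "e \<in> bnd X D V'" and f: "f \<in> bnd X D K'"
  shows "arc_compatible X D K K'"
proof -
  note S1 = splittingD[OF s1] and S2 = splittingD[OF s2]
  have noV': "endp X D a \<notin> K" "endp X D a \<notin> K'" if "a \<in> arcs D" "endp (opp X) D a \<in> V'" for a
    using S1(7)[OF that] S2(1) by blast+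
  have noK': "endp X D a \<notin> K" if "a \<in> arcs D" "endp (opp X) D a \<in> K'" for a
    using S2(7)[OF that] .
  have K'V': "endp X D a \<notin> V'" if "a \<in> arcs D" "endp (opp X) D a \<in> K'" for a
    using nl that linkedI[of a D "opp X" K' V'] by auto
  have dj: "K \<inter> V' = {}" "K' \<inter> V' = {}" "K \<inter> K' = {}" using S1(2) S2(1,2) by blast+
  have finKV: "finite (K \<union> V')" "finite (K \<union> K')"
    by (rule finite_subset[OF _ fin], use S1(1) S2(1) in blast)+
  have lK: "linked D K K'" using splitting_linked[OF s2 S1(5)] .
  have V: "V = K \<union> K'" using S2(1) by simp
  have "conn D (K \<union> V')" using conn_Un[OF S2(5) S1(6)] l by blast
  then have "splitting X D U (K \<union> V') K'"
    unfolding splitting_def using S1 S2 dj K'V' by auto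
  then obtain L R where L: "arc_grounded X D (K \<union> V') L" and R: "arc_grounded (opp X) D K' R"
    and LR: "compatible_lists L R"
    using U(2) unfolding all_splittings_compatible_def arc_compatible_def by blast
  obtain M N where M: "arc_grounded X D V M" and N: "arc_grounded (opp X) D V' N"
    and MN: "compatible_lists M N"
    using U(2) s1 unfolding all_splittings_compatible_def arc_compatible_def by blast
  \<comment> \<open>\<open>A\<close> is what becomes internal in \<open>K \<union> V'\<close> and is
    therefore missing from \<open>L\<close>; the remaining boundary arcs \<open>S\<close> of
    \<open>K\<close> all occur in \<open>L\<close>.\<close>
  define A where "A = {a \<in> arcs D. endp (opp X) D a \<in> K \<and> endp X D a \<in> V'}"
  define S where "S = bnd X D K - A"
  have SA: "S \<union> A = bnd X D K" using dj by (auto simp: S_def A_def bnd_def)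
  have SA_dj: "S \<inter> A = {}" by (auto simp: S_def)
  have SL: "S \<subseteq> set L" and eL: "e \<in> set L"
    using arc_groundedD(2)[OF L] noV' e by (auto simp: S_def A_def bnd_def)
  have LS: "set L \<inter> bnd X D K = S"
    using arc_groundedD(2)[OF L] dj by (auto simp: S_def A_def bnd_def)
  have eS: "e \<notin> bnd X D K" using e dj by (auto simp: bnd_def)
  have AM: "A \<subseteq> set M" and fM: "f \<in> set M"
    using arc_groundedD(2)[OF M] noK' f dj unfolding V by (auto simp: A_def bnd_def)
  have fK: "f \<notin> bnd X D K" using f dj by (auto simp: bnd_def)
  obtain pL :: "'b \<Rightarrow> int" where pL: "sorted_wrt (\<lambda>x y. pL x < pL y) L"
    using sorted_wrt_rank[OF arc_groundedD(1)[OF L]] by blast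
  obtain pM :: "'b \<Rightarrow> int" where pM: "sorted_wrt (\<lambda>x y. pM x < pM y) M"
    using sorted_wrt_rank[OF arc_groundedD(1)[OF M]] by blast
  \<comment> \<open>These are the maps \<open>r\<close> of \<open>crossing_absorb\<close>,
    contracting \<open>V'\<close> to \<open>e\<close> and \<open>K'\<close> to \<open>f\<close>.
    Hence \<open>p\<close> gives all of \<open>A\<close> the position of \<open>e\<close>, and
    \<open>q\<close> gives all arcs from \<open>K\<close> to \<open>K'\<close> the position of
    \<open>f\<close>. Integer positions allow such merging, and reversal by a sign.\<close>
  define rL where "rL a = (if endp X D a \<in> V' then e else a)" for a
  define rM where "rM a = (if endp X D a \<in> K' then f else a)" for a
  define p where "p a = pL (rL a)" for a
  define q where "q a = pM (rM a)" for a
  have injL: "pL x \<noteq> pL y" if "x \<in> set L" "y \<in> set L" "x \<noteq> y" for x y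
    using that pL by (metis (mono_tags, lifting) less_irrefl sorted_wrt_iff_nth_less in_set_conv_nth nat_neq_iff)
  have injM: "pM x \<noteq> pM y" if "x \<in> set M" "y \<in> set M" "x \<noteq> y" for x y
    using that pM by (metis (mono_tags, lifting) less_irrefl sorted_wrt_iff_nth_less in_set_conv_nth nat_neq_iff)
  have rLA: "rL a = e" if "a \<in> A" for a using that by (simp add: rL_def A_def)
  have rLS: "rL a = a" if "a \<in> S" for a using that by (auto simp: rL_def S_def A_def bnd_def)
  have rMA: "rM a = a" if "a \<in> A" for a using that dj by (auto simp: rM_def A_def)
  have rL: "rL a \<in> set L" if "a \<in> S \<union> A" for a using that rLA rLS eL SL by auto
  have rM: "rM a \<in> set M" if "a \<in> S \<union> A" for a
    using that arc_groundedD(2)[OF M] fM SA unfolding V by (auto simp: rM_def bnd_def)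
  have SAarcs: "a \<in> arcs D" if "a \<in> S \<union> A" for a using that SA by (auto simp: bnd_def)
  have pcr: "\<not> crossing X D K x y z" if "{x, y, z} \<subseteq> S \<union> A" "p x < p y" "p y < p z" for x y z
  proof
    assume "crossing X D K x y z"
    moreover have ne: "rL x \<noteq> rL y" "rL z \<noteq> rL y" using that(2,3) unfolding p_def by auto
    ultimately have "crossing X D (K \<union> V') (rL x) (rL y) (rL z)"
      using e that SAarcs
      by (intro crossing_absorb[OF finKV(1) S2(5) S1(6) dj(1) l noV'(1), where f = e])
        (auto simp: bnd_def rL_def[abs_def])
    moreover have "in_between L (rL x) (rL y) (rL z)"
      using that rL by (intro in_between_rank[OF pL]) (auto simp: p_def)
    ultimately show False using arc_groundedD(3)[OF L] by blast
  qed
  have qcr: "\<not> crossing X D K x y z" if "{x, y, z} \<subseteq> S \<union> A" "q x < q y" "q y < q z" for x y z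
  proof
    assume "crossing X D K x y z"
    moreover have ne: "rM x \<noteq> rM y" "rM z \<noteq> rM y" using that(2,3) unfolding q_def by auto
    ultimately have "crossing X D (K \<union> K') (rM x) (rM y) (rM z)"
      using f that SAarcs
      by (intro crossing_absorb[OF finKV(2) S2(5,6) dj(3) lK noK', where f = f])
        (auto simp: bnd_def rM_def[abs_def])
    moreover have "in_between M (rM x) (rM y) (rM z)"
      using that rM by (intro in_between_rank[OF pM]) (auto simp: q_def)
    ultimately show False using arc_groundedD(3)[OF M] unfolding V by blast
  qed
  have pA: "p a = pL e" if "a \<in> A" for a using rLA[OF that] by (simp add: p_def)
  have pS: "p a = pL a" if "a \<in> S" for a using rLS[OF that] by (simp add: p_def)
  have pSe: "p a \<noteq> pL e" if "a \<in> S" for a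
    using that pS[OF that] injL[of a e] SL eL eS SA by auto
  \<comment> \<open>The overlap of \<open>M\<close> and \<open>N\<close> is exactly
    \<open>A\<close>, so \<open>A\<close> is an infix of \<open>M\<close>. As \<open>rM\<close>
    keeps \<open>S\<close> out of \<open>A\<close>, \<open>q\<close> places each element of
    \<open>S\<close> before or after the whole of \<open>A\<close>.\<close>
  obtain m1 ms m2 where Ms: "M = m1 @ ms @ m2" "set ms = set M \<inter> set N"
    using compatible_lists_split[OF MN] by metis
  have set_ms: "set ms = A"
    using Ms(2) arc_groundedD(2)[OF M] arc_groundedD(2)[OF N] K'V' S1(2) unfolding V
    by (auto simp: A_def bnd_def)
  have qS: "(\<forall>a \<in> A. q s < q a) \<or> (\<forall>a \<in> A. q a < q s)" if "s \<in> S" for s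
  proof -
    have qA: "q a = pM a" if "a \<in> A" for a using rMA[OF that] by (simp add: q_def)
    have "rM s \<notin> A"
      using that K'V' f by (auto simp: rM_def A_def S_def bnd_def)
    then have "rM s \<in> set m1 \<or> rM s \<in> set m2"
      using rM[of s] that set_ms unfolding Ms(1) by auto
    then show ?thesis
      using pM qA set_ms unfolding Ms(1) q_def by (auto simp: sorted_wrt_append)
  qed
  obtain l1 ls l2 where Ls: "L = l1 @ ls @ l2" "set ls = set L \<inter> set R"
    using compatible_lists_split[OF LR] by metis
  have set_ls: "set ls = {a \<in> arcs D. endp (opp X) D a \<in> K \<and> endp X D a \<in> K'}"
    using Ls(2) arc_groundedD(2)[OF L] arc_groundedD(2)[OF R] noV' dj
    by (auto simp: bnd_def)
  have "e \<notin> set ls" using e dj by (auto simp: set_ls bnd_def)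
  then have "e \<in> set l1 \<or> e \<in> set l2" using eL Ls(1) by auto
  then have ls_side: "(\<forall>a \<in> set ls. pL a < pL e) \<or> (\<forall>a \<in> set ls. pL e < pL a)"
    using pL unfolding Ls(1) by (auto simp: sorted_wrt_append)
  \<comment> \<open>Distinct arcs of \<open>S\<close> share a \<open>q\<close>-position only if both
    lead to \<open>K'\<close>. Those arcs form the overlap of \<open>L\<close> and \<open>R\<close>,
    an infix of \<open>L\<close> without \<open>e\<close>, so all of them are on the same side of
    \<open>e\<close>.\<close>
  have qinj: "p s < pL e \<longleftrightarrow> p t < pL e" if "s \<in> S" "t \<in> S" "q s = q t" for s t
  proof (cases "s = t")
    case False
    have "rM s = rM t" using that injM[of "rM s" "rM t"] rM[of s] rM[of t] by (auto simp: q_def)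
    then have "endp X D s \<in> K'" "endp X D t \<in> K'"
      using False that fK SA by (auto simp: rM_def split: if_splits)
    then have "s \<in> set ls" "t \<in> set ls" using that SA unfolding set_ls by (auto simp: bnd_def)
    then show ?thesis using ls_side pS that by fastforce
  qed auto
  have "\<exists>\<epsilon>. (\<epsilon> = 1 \<or> \<epsilon> = -1) \<and> (\<forall>s \<in> S. \<forall>a \<in> A. \<forall>b \<in> A. \<epsilon> * q a < \<epsilon> * q b \<longrightarrow>
       (p s < pL e \<longrightarrow> \<not> crossing X D K s a b) \<and> (pL e < p s \<longrightarrow> \<not> crossing X D K a b s))"
  proof (rule orientation_exists)
    show "crossing X D K z y x" if "crossing X D K x y z" for x y z
      using that by (rule crossing_commute)
    show "crossing X D K x s z \<or> crossing X D K x y s \<and> crossing X D K s y z"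
      if "crossing X D K x y z" "s \<in> S" for x y z s
      using crossing_fourth[OF that(1)] that(2) SA by (auto simp: bnd_def)
    show "p s \<noteq> p t" if "s \<in> S" "t \<in> S" "s \<noteq> t" for s t
      using that pS injL SL by (metis subsetD)
    show "\<not> crossing X D K x y z" if "{x, y, z} \<subseteq> S \<union> A" "p x < p y" "p y < p z" for x y z
      using that by (rule pcr)
    show "\<not> crossing X D K x y z" if "{x, y, z} \<subseteq> S \<union> A" "q x < q y" "q y < q z" for x y z
      using that by (rule qcr)
    show "p a = pL e" if "a \<in> A" for a using that by (rule pA)
    show "p s \<noteq> pL e" if "s \<in> S" for s using that by (rule pSe)
    show "(\<forall>a \<in> A. q s < q a) \<or> (\<forall>a \<in> A. q a < q s)" if "s \<in> S" for s using that by (rule qS)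
    show "p s < pL e \<longleftrightarrow> p t < pL e" if "s \<in> S" "t \<in> S" "q s = q t" for s t
      using that by (rule qinj)
  qed
  then obtain \<epsilon> :: int where \<epsilon>: "\<epsilon> = 1 \<or> \<epsilon> = -1"
    "\<And>s a b. s \<in> S \<Longrightarrow> a \<in> A \<Longrightarrow> b \<in> A \<Longrightarrow> \<epsilon> * q a < \<epsilon> * q b \<Longrightarrow>
       (p s < pL e \<longrightarrow> \<not> crossing X D K s a b) \<and> (pL e < p s \<longrightarrow> \<not> crossing X D K a b s)"
    by blast
  define \<sigma> where "\<sigma> = (if \<epsilon> = 1 then ms else rev ms)"
  have set_\<sigma>: "set \<sigma> = A" by (simp add: \<sigma>_def set_ms)
  have "sorted_wrt (\<lambda>x y. pM x < pM y) ms" using pM unfolding Ms(1) by (simp add: sorted_wrt_append)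
  then have "sorted_wrt (\<lambda>x y. q x < q y) ms"
    by (rule sorted_wrt_mono_rel[rotated]) (simp add: set_ms q_def rMA)
  then have sorted_\<sigma>: "sorted_wrt (\<lambda>x y. \<epsilon> * q x < \<epsilon> * q y) \<sigma>"
    using \<epsilon>(1) by (auto simp: \<sigma>_def sorted_wrt_rev)
  have distinct_\<sigma>: "distinct \<sigma>"
    using arc_groundedD(1)[OF M] Ms(1) by (auto simp: \<sigma>_def)
  \<comment> \<open>\<open>e\<close> is expanded into the oriented list of \<open>A\<close>, the
    arcs of \<open>S\<close> stay, and the other arcs leaving \<open>V'\<close> are dropped.\<close>
  define g where "g x = (if x = e then \<sigma> else if x \<in> bnd X D K then [x] else [])" for x
  define Z where "Z = concat (map g L)"
  obtain la lb where Lab: "L = la @ e # lb" using eL by (meson split_list)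
  have elab: "e \<notin> set la" "e \<notin> set lb" using arc_groundedD(1)[OF L] Lab by auto
  have Z: "Z = filter (\<lambda>x. x \<in> bnd X D K) la @ \<sigma> @ filter (\<lambda>x. x \<in> bnd X D K) lb"
  proof -
    have "concat (map g la) = filter (\<lambda>x. x \<in> bnd X D K) la"
      "concat (map g lb) = filter (\<lambda>x. x \<in> bnd X D K) lb"
      using elab by (auto intro!: concat_map_filter_singletons simp: g_def)
    then show ?thesis by (simp add: Z_def Lab g_def)
  qed
  have lab: "set (filter (\<lambda>x. x \<in> bnd X D K) la) \<union> set (filter (\<lambda>x. x \<in> bnd X D K) lb) = S"
    using LS eS Lab by auto
  have set_Z: "set Z = bnd X D K" using lab set_\<sigma> SA unfolding Z by auto
  have distinct_Z: "distinct Z"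
    using arc_groundedD(1)[OF L] lab set_\<sigma> SA_dj distinct_\<sigma> unfolding Z Lab by auto
  \<comment> \<open>The order of the list \<open>Z\<close>: positions in \<open>L\<close>, with the
    ties inside \<open>A\<close> broken by the chosen orientation of \<open>q\<close>.\<close>
  define before where "before x y \<longleftrightarrow> p x < p y \<or> p x = p y \<and> \<epsilon> * q x < \<epsilon> * q y" for x y
  have "sorted_wrt before (filter (\<lambda>x. x \<in> bnd X D K) xs)" if "sorted_wrt (\<lambda>x y. pL x < pL y) xs"
    "set (filter (\<lambda>x. x \<in> bnd X D K) xs) \<subseteq> S" for xs
  proof (rule sorted_wrt_mono_rel[OF _ sorted_wrt_filter[OF that(1)]])
    fix x y assume "x \<in> set (filter (\<lambda>x. x \<in> bnd X D K) xs)"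
      "y \<in> set (filter (\<lambda>x. x \<in> bnd X D K) xs)" "pL x < pL y"
    then show "before x y" using that(2) pS by (auto simp: before_def subset_eq)
  qed
  then have "sorted_wrt before (filter (\<lambda>x. x \<in> bnd X D K) la)"
      "sorted_wrt before (filter (\<lambda>x. x \<in> bnd X D K) lb)"
    using pL lab unfolding Lab by (auto simp: sorted_wrt_append)
  moreover have "sorted_wrt before \<sigma>"
    by (rule sorted_wrt_mono_rel[OF _ sorted_\<sigma>]) (simp add: before_def set_\<sigma> pA)
  moreover have "before x y" if "x \<in> set (filter (\<lambda>x. x \<in> bnd X D K) la)"
    "y \<in> set \<sigma> \<union> set (filter (\<lambda>x. x \<in> bnd X D K) lb)" for x y
  proof -
    have "x \<in> S" "y \<in> A \<or> y \<in> S" using that lab set_\<sigma> by auto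
    then have "p x = pL x" "p y = pL e \<or> p y = pL y \<and> y \<in> set lb" 
      using pS pA that set_\<sigma> SA_dj by auto
    then show ?thesis using pL that unfolding Lab by (auto simp: before_def sorted_wrt_append)
  qed
  moreover have "before x y" if "x \<in> set \<sigma>" "y \<in> set (filter (\<lambda>x. x \<in> bnd X D K) lb)" for x y
  proof -
    have "y \<in> S" "x \<in> A" using that lab set_\<sigma> by auto
    then have "p x = pL e" "p y = pL y" using pS pA by auto
    then show ?thesis using pL that unfolding Lab by (auto simp: before_def sorted_wrt_append)
  qed
  ultimately have sorted_Z: "sorted_wrt before Z"
    unfolding Z sorted_wrt_append by auto
  have same_p: "x \<in> A \<and> y \<in> A" if "x \<in> S \<union> A" "y \<in> S \<union> A" "p x = p y" "before x y" for x y
  proof -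
    have "x \<noteq> y" using that(4) by (auto simp: before_def)
    then have "\<not> (x \<in> S \<and> y \<in> S)" using that(3) pS injL[of x y]
      subsetD[OF SL, of x] subsetD[OF SL, of y] by auto
    then show ?thesis using that pSe[of x] pSe[of y] pA[of x] pA[of y] by auto
  qed
  \<comment> \<open>Without ties \<open>p\<close> excludes the crossing, with three equal positions
    \<open>q\<close> does, and with exactly one tie two of the arcs lie in \<open>A\<close> and the
    choice of \<epsilon> does.\<close>
  have cr: "\<not> crossing X D K x y z"
    if "{x, y, z} \<subseteq> S \<union> A" "before x y" "before y z" for x y z
  proof (cases "p x = p y")
    case True
    then have xy: "x \<in> A" "y \<in> A" using same_p that by auto
    then have qxy: "\<epsilon> * q x < \<epsilon> * q y" using that True by (auto simp: before_def)
    show ?thesis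
    proof (cases "p y = p z")
      case yz: True
      then have "\<epsilon> * q y < \<epsilon> * q z" using that by (auto simp: before_def)
      then have "q x < q y \<and> q y < q z \<or> q z < q y \<and> q y < q x" using qxy \<epsilon>(1) by auto
      then show ?thesis
      proof
        assume "q x < q y \<and> q y < q z"
        then show ?thesis using that(1) by (intro qcr) auto
      next
        assume "q z < q y \<and> q y < q x"
        then have "\<not> crossing X D K z y x" using that(1) by (intro qcr) auto
        then show ?thesis using crossing_commute[of X D K x y z] by blast
      qed
    next
      case False
      then have "p y < p z" using that by (auto simp: before_def)
      then have "z \<in> S" "pL e < p z" using that pA xy by auto
      then show ?thesis using \<epsilon>(2)[of z x y] xy qxy by blast
    qed
  next
    case False
    then have pxy: "p x < p y" using that by (auto simp: before_def)
    show ?thesis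
    proof (cases "p y = p z")
      case True
      then have yz: "y \<in> A" "z \<in> A" using same_p that by auto
      then have qyz: "\<epsilon> * q y < \<epsilon> * q z" using that True by (auto simp: before_def)
      have "x \<in> S" "p x < pL e" using that pxy pA yz by auto
      then show ?thesis using \<epsilon>(2)[of x y z] yz qyz by blast
    next
      case False
      then have "p y < p z" using that by (auto simp: before_def)
      then show ?thesis using that(1) pxy by (intro pcr) auto
    qed
  qed
  have "arc_grounded X D K Z"
    unfolding arc_grounded_def
  proof (intro conjI allI impI distinct_Z set_Z)
    fix a b c assume ib: "in_between Z a b c"
    have abc: "{a, b, c} \<subseteq> S \<union> A" "{c, b, a} \<subseteq> S \<union> A"
      using in_between_set[OF ib] set_Z SA by auto
    have "before a b \<and> before b c \<or> before c b \<and> before b a"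
      using in_between_sorted_wrt[OF ib sorted_Z] by blast
    then show "\<not> crossing X D K a b c"
      using cr[OF abc(1)] cr[OF abc(2)] crossing_commute[of X D K a b c] by blast
  qed
  moreover have "compatible_lists Z R"
    unfolding Z_def
  proof (rule compatible_lists_concat_map[OF LR])
    have R': "x \<in> arcs D \<and> endp X D x \<in> K'" if "x \<in> set R" for x
      using that arc_groundedD(2)[OF R] by (auto simp: bnd_def)
    have eR: "e \<notin> set R" using R' noV'(2)[of e] e by (auto simp: bnd_def)
    show "g x = [x]" if "x \<in> set L \<inter> set R" for x
      using that Ls(2) set_ls dj eR by (auto simp: g_def bnd_def)
    show "distinct (concat (map g L))" using distinct_Z by (simp add: Z_def)
    have "A \<inter> set R = {}" using R' dj by (auto simp: A_def)
    then show "set (g x) \<inter> set R = {}" if "x \<in> set L - set R" for x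
      using that by (auto simp: g_def set_\<sigma>)
  qed
  ultimately show ?thesis using R unfolding arc_compatible_def by blast
qed

text \<open>Since \<open>V'\<close> is linked to \<open>V\<close>, it is linked to \<open>K'\<close>
  or else to \<open>K\<close>, which decides between the two constructions. The hypothesis
  \<open>out\<close> supplies the arcs \<open>e\<close> and \<open>f\<close> that represent
  \<open>V'\<close> and \<open>K'\<close>.\<close>

lemma all_splittings_compatible_hereditary:
  assumes fin: "finite U" and U: "conn D U" "all_splittings_compatible D U"
    and out: "\<And>X V. V \<subseteq> U \<Longrightarrow> V \<noteq> {} \<Longrightarrow> bnd X D V \<noteq> {}"
    and s1: "splitting X D U V V'"
  shows "all_splittings_compatible D V"
proof -
  note S1 = splittingD[OF s1]
  have main: "arc_compatible X D K K'" if s2: "splitting X D V K K'" for K K'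
  proof -
    note S2 = splittingD[OF s2]
    obtain e f where ef: "e \<in> bnd X D V'" "f \<in> bnd X D K'"
      using out[of V' X] out[of K' X] S1(1,4) S2(1,4) by blast
    show ?thesis
    proof (cases "linked D K' V'")
      case True
      then show ?thesis using arc_compatible_linked_later[OF fin U s1 s2 _ ef(1)] by blast
    next
      case False
      have "linked D V' (K \<union> K')"
        using splitting_linked[OF s1 U(1)] linked_commute S2(1) by metis
      then have "linked D K V'" using False linked_Un linked_commute by metis
      then show ?thesis using arc_compatible_linked_earlier[OF fin U s1 s2 False _ ef] by blast
    qed
  qed
  show ?thesis
    unfolding all_splittings_compatible_def
  proof (intro allI impI)
    fix Y K K' assume s: "splitting Y D V K K'"
    show "arc_compatible Y D K K'"
    proof (cases "Y = X")
      case True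
      then show ?thesis using main s by blast
    next
      \<comment> \<open>A splitting in the other direction is one in direction \<open>X\<close> with
        \<open>K\<close> and \<open>K'\<close> exchanged.\<close>
      case False
      then have Y: "opp Y = X" by (cases X; cases Y) auto
      then have "arc_compatible X D K' K" using main s splitting_commute by metis
      then show ?thesis using arc_compatible_commute Y by (metis opp_opp)
    qed
  qed
qed

section \<open>Semipaths and connectedness\<close>

lemma linked_ends:
  assumes "a \<in> arcs D" "{tail D a, head D a} = {x, y}" shows "linked D {x} {y}"
  using assms linkedI[of a D West "{x}" "{y}"] linkedI[of a D East "{x}" "{y}"]
  by (auto simp: doubleton_eq_iff)

lemma semipath_conn:
  assumes "semipath D p" shows "conn D (set (fst p))"
proof -
  obtain vs as where p: "p = (vs, as)" by fastforce
  have len: "length vs = Suc (length as)" and arcs: "set as \<subseteq> arcs D"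
    and ends: "\<And>i. i < length as \<Longrightarrow> {tail D (as ! i), head D (as ! i)} = {vs ! i, vs ! Suc i}"
    using assms by (auto simp: p semipath_def)
  have "n \<le> length as \<Longrightarrow> conn D (set (take (Suc n) vs))" for n
  proof (induction n)
    case 0
    then show ?case using len by (cases vs) auto
  next
    case (Suc n)
    have tk: "take (Suc (Suc n)) vs = take (Suc n) vs @ [vs ! Suc n]"
      using Suc.prems len by (intro take_Suc_conv_app_nth) simp
    have "linked D {vs ! n} {vs ! Suc n}"
      using Suc.prems arcs ends[of n] by (intro linked_ends[of "as ! n"]) (auto simp: subset_eq)
    moreover have "vs ! n \<in> set (take (Suc n) vs)"
      using Suc.prems len by (auto simp: in_set_conv_nth intro!: exI[of _ n])
    ultimately have "linked D (set (take (Suc n) vs)) {vs ! Suc n}"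
      by (elim linked_mono) auto
    then show ?case using conn_insert[of D "set (take (Suc n) vs)" "vs ! Suc n"] Suc by (simp add: tk)
  qed
  from this[of "length as"] show ?thesis using len by (simp add: p)
qed

lemma semipath_ends:
  assumes "p \<in> semipaths D u v" shows "u \<in> set (fst p)" "v \<in> set (fst p)" "semipath D p"
proof -
  have "fst p \<noteq> []" using assms by (auto simp: semipaths_def semipath_def)
  then show "u \<in> set (fst p)" "v \<in> set (fst p)" "semipath D p"
    using assms by (auto simp: semipaths_def)
qed

lemma semipath_verts: "semipath D p \<Longrightarrow> set (fst p) \<subseteq> verts D"
  by (auto simp: semipath_def)

lemma semipath_extend:
  assumes p: "p \<in> semipaths D u x" and a: "a \<in> arcs D" "{tail D a, head D a} = {x, y}" and y: "y \<in> verts D"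
  shows "\<exists>q \<in> semipaths D u y. set (fst q) \<subseteq> insert y (set (fst p))"
proof -
  obtain vs as where vs: "p = (vs, as)" by fastforce
  have sp: "length vs = Suc (length as)" "set vs \<subseteq> verts D" "set as \<subseteq> arcs D" "distinct vs"
    "\<And>i. i < length as \<Longrightarrow> {tail D (as ! i), head D (as ! i)} = {vs ! i, vs ! Suc i}"
    "hd vs = u" "last vs = x"
    using p by (auto simp: vs semipath_def semipaths_def)
  have ne: "vs \<noteq> []" using sp(1) by auto
  show ?thesis
  proof (cases "y \<in> set vs")
    \<comment> \<open>If \<open>y\<close> was visited already, truncating the semipath at
      \<open>y\<close> avoids a repeated vertex.\<close>
    case True
    then obtain i where i: "i < length vs" "vs ! i = y" by (auto simp: in_set_conv_nth)
    have "last (take (Suc i) vs) = y" using i by (simp add: take_Suc_conv_app_nth)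
    then have "(take (Suc i) vs, take i as) \<in> semipaths D u y"
      using sp i ne by (auto simp: semipaths_def semipath_def dest: in_set_takeD)
    then show ?thesis by (rule bexI[rotated]) (auto simp: vs dest: in_set_takeD)
  next
    case False
    have "last vs = vs ! length as" using sp(1) ne by (simp add: last_conv_nth)
    then have "{tail D ((as @ [a]) ! i), head D ((as @ [a]) ! i)} = {(vs @ [y]) ! i, (vs @ [y]) ! Suc i}"
      if "i < length (as @ [a])" for i
      using that sp(1,5,7) a(2) by (cases "i = length as") (auto simp: nth_append)
    then have "(vs @ [y], as @ [a]) \<in> semipaths D u y"
      using sp(1-4,6) ne False y a(1) by (simp add: semipaths_def semipath_def)
    then show ?thesis by (rule bexI[rotated]) (auto simp: vs)
  qed
qed

text \<open>Otherwise an arc inside \<open>S\<close> would leave the set of vertices reachable from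
  \<open>u\<close> within \<open>S\<close>, against \<open>semipath_extend\<close>.\<close>

lemma conn_semipath:
  assumes S: "conn D S" "S \<subseteq> verts D" and u: "u \<in> S" and v: "v \<in> S"
  shows "\<exists>p \<in> semipaths D u v. set (fst p) \<subseteq> S"
proof -
  define R where "R = {x \<in> S. \<exists>p \<in> semipaths D u x. set (fst p) \<subseteq> S}"
  have "([u], []) \<in> semipaths D u u" using u S by (auto simp: semipaths_def semipath_def)
  then have uR: "u \<in> R" using u by (force simp: R_def)
  have "R = S"
  proof (rule ccontr)
    assume "R \<noteq> S"
    then have "linked D R (S - R)" using uR by (intro connD[OF S(1)]) (auto simp: R_def)
    then obtain a X where a: "a \<in> arcs D" "endp X D a \<in> R" "endp (opp X) D a \<in> S - R"
      unfolding linked_def by blast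
    then obtain p where p: "p \<in> semipaths D u (endp X D a)" "set (fst p) \<subseteq> S"
      unfolding R_def by blast
    have "{tail D a, head D a} = {endp X D a, endp (opp X) D a}" by (cases X) auto
    then obtain q where "q \<in> semipaths D u (endp (opp X) D a)"
      "set (fst q) \<subseteq> insert (endp (opp X) D a) (set (fst p))"
      using semipath_extend[OF p(1) a(1)] a(3) S(2) by blast
    then have "endp (opp X) D a \<in> R" unfolding R_def using p(2) a(3) by blast
    then show False using a(3) by blast
  qed
  then show ?thesis using v by (auto simp: R_def)
qed

lemma weakly_connected_iff_conn: "weakly_connected D \<longleftrightarrow> conn D (verts D)"
proof
  assume wc: "weakly_connected D"
  show "conn D (verts D)"
    unfolding conn_def
  proof (intro allI impI)
    fix T assume T: "T \<subseteq> verts D" "T \<noteq> {} \<and> T \<noteq> verts D"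
    then obtain u v where uv: "u \<in> T" "v \<in> verts D" "v \<notin> T" by blast
    then have "u \<in> verts D" "u \<noteq> v" using T by blast+
    then have "semipaths D u v \<noteq> {}" using wc uv(2) unfolding weakly_connected_def by blast
    then obtain p where p: "p \<in> semipaths D u v" by (meson ex_in_conv)
    note e = semipath_ends[OF p]
    have "linked D (T \<inter> set (fst p)) (set (fst p) - T \<inter> set (fst p))"
      using e uv by (intro connD[OF semipath_conn[OF e(3)]]) auto
    then show "linked D T (verts D - T)"
      using semipath_verts[OF e(3)] by (elim linked_mono) auto
  qed
next
  assume "conn D (verts D)"
  then show "weakly_connected D"
    unfolding weakly_connected_def using conn_semipath[of D "verts D"] by (metis empty_iff subset_refl)
qed

section \<open>Acyclicity\<close>

lemma cas_reachable:
  "pre_digraph.cas D u p v \<Longrightarrow> set p \<subseteq> arcs D \<Longrightarrow> (u, v) \<in> (arcs_ends D)\<^sup>*"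
proof (induction p arbitrary: u)
  case (Cons a p)
  have "(tail D a, head D a) \<in> arcs_ends D" using Cons.prems by (auto simp: arcs_ends_conv)
  then show ?case using Cons by (auto simp: pre_digraph.cas.simps intro: converse_rtrancl_into_rtrancl)
qed (simp add: pre_digraph.cas.simps)

lemma acyclic_digraphI:
  assumes "acyclic (arcs_ends D)" shows "acyclic_digraph D"
  unfolding acyclic_digraph_def
proof
  assume "\<exists>p. pre_digraph.cycle D p"
  then obtain u a p where w: "pre_digraph.awalk D u (a # p) u"
    unfolding pre_digraph.cycle_def by (metis list.exhaust)
  then have "a \<in> arcs D" "tail D a = u" and p: "pre_digraph.cas D (head D a) p u" "set p \<subseteq> arcs D"
    by (auto simp: pre_digraph.awalk_def pre_digraph.cas.simps)
  then have "(u, head D a) \<in> arcs_ends D" by (auto simp: arcs_ends_conv)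
  from this cas_reachable[OF p] have "(u, u) \<in> (arcs_ends D)\<^sup>+" by (rule rtrancl_into_trancl2)
  then show False using assms by (auto simp: acyclic_def)
qed

lemma acyclic_digraphD:
  assumes "wf_digraph D" "acyclic_digraph D" shows "acyclic (arcs_ends D)"
proof -
  interpret wf_digraph D by fact
  show ?thesis
  proof (rule acyclicI, intro allI notI)
    fix x assume "(x, x) \<in> (arcs_ends D)\<^sup>+"
    then obtain p where "awalk x p x" "p \<noteq> []" unfolding reachable1_awalk by blast
    then have "closed_w p" unfolding closed_w_def by blast
    then show False using closed_w_imp_cycle assms(2) unfolding acyclic_digraph_def by blast
  qed
qed

lemma D_graphD:
  assumes "D_graph D"
  shows "wf_digraph D" "finite (verts D)" "finite (arcs D)" "acyclic (arcs_ends D)"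
    "WE_functional D" "conn D (verts D)" "inner_verts D \<noteq> {}"
  using assms acyclic_digraphD fin_digraph.axioms(1)
  unfolding D_graph_def weakly_connected_iff_conn
  by (auto simp: fin_digraph_def fin_digraph_axioms_def)

section \<open>Extremal vertices and the existence of splittings\<close>

lemma endp_in_verts: "wf_digraph D \<Longrightarrow> a \<in> arcs D \<Longrightarrow> endp X D a \<in> verts D"
  by (cases X) (auto simp: wf_digraph_def)

text \<open>A finite acyclic relation is well-founded in both directions, so \<open>V\<close> has a
  source (\<open>X = West\<close>) and a sink (\<open>X = East\<close>).\<close>

lemma extremal_vertex:
  assumes D: "D_graph D" and V: "V \<noteq> {}"
  obtains x where "x \<in> V" "\<And>a. a \<in> arcs D \<Longrightarrow> endp (opp X) D a = x \<Longrightarrow> endp X D a \<notin> V"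
proof -
  note d = D_graphD[OF D]
  have fin: "finite (arcs_ends D)" using d(3) by (simp add: arcs_ends_def)
  have wf: "wf (arcs_ends D)" "wf ((arcs_ends D)\<inverse>)"
    using finite_acyclic_wf[OF fin d(4)] finite_acyclic_wf_converse[OF fin d(4)] by auto
  obtain v where v: "v \<in> V" using V by blast
  show thesis
  proof (cases X)
    case West
    from wfE_min[OF wf(1) v] obtain x where "x \<in> V" "\<And>y. (y, x) \<in> arcs_ends D \<Longrightarrow> y \<notin> V" by blast
    then show thesis using that West by (force simp: arcs_ends_conv)
  next
    case East
    from wfE_min[OF wf(2) v] obtain x where "x \<in> V" "\<And>y. (y, x) \<in> (arcs_ends D)\<inverse> \<Longrightarrow> y \<notin> V" by blast
    then show thesis using that East by (force simp: arcs_ends_conv)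
  qed
qed

lemma inner_vertsD: "x \<in> inner_verts D \<Longrightarrow> \<exists>a \<in> arcs D. endp X D a = x"
  unfolding inner_verts_def side_verts_def by (cases X) auto

text \<open>An extremal vertex of \<open>V\<close> is inner, hence has an arc towards side
  \<open>X\<close>, and by extremality this arc leaves \<open>V\<close>.\<close>

lemma bnd_nonempty:
  assumes D: "D_graph D" and V: "V \<subseteq> inner_verts D" "V \<noteq> {}" shows "bnd X D V \<noteq> {}"
proof -
  obtain x where x: "x \<in> V" "\<And>a. a \<in> arcs D \<Longrightarrow> endp (opp X) D a = x \<Longrightarrow> endp X D a \<notin> V"
    by (rule extremal_vertex[OF D V(2), of X]) blast
  then have "x \<in> inner_verts D" using V(1) by blast
  from inner_vertsD[OF this] obtain a where "a \<in> arcs D" "endp (opp X) D a = x" by metis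
  then have "a \<in> bnd X D V" using x by (auto simp: bnd_def)
  then show ?thesis by blast
qed

lemma splitting_exists:
  assumes D: "D_graph D" and U: "finite U" "conn D U" "\<not> (\<exists>x. U \<subseteq> {x})"
  obtains V V' where "splitting East D U V V'"
proof -
  have "U \<noteq> {}" using U(3) by blast
  then obtain x where x: "x \<in> U" "\<And>a. a \<in> arcs D \<Longrightarrow> endp (opp West) D a = x \<Longrightarrow> endp West D a \<notin> U"
    by (rule extremal_vertex[OF D, of U West]) blast
  obtain y where y: "y \<in> U - {x}" using U(3) by blast
  define F where "F = {Q. Q \<subseteq> U - {x} \<and> Q \<noteq> {} \<and> conn D Q}"
  have "finite F" by (rule finite_subset[of _ "Pow U"]) (use U(1) in \<open>auto simp: F_def\<close>)
  moreover have "{y} \<in> F" using y by (auto simp: F_def)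
  ultimately obtain Q where Q: "Q \<in> F" "\<And>R. R \<in> F \<Longrightarrow> Q \<subseteq> R \<Longrightarrow> R = Q"
    using finite_has_maximal[of F] by (metis empty_iff)
  have nl: "\<not> linked D Q (U - {x} - Q)"
  proof
    assume "linked D Q (U - {x} - Q)"
    then obtain z where z: "z \<in> U - {x} - Q" "linked D Q {z}" by (rule linked_singleton)
    then have "insert z Q \<in> F" using Q(1) conn_insert[of D Q z] by (auto simp: F_def)
    then show False using Q(2)[of "insert z Q"] z(1) by blast
  qed
  have cV: "conn D (U - Q)"
    unfolding conn_def
  proof (intro allI impI)
    fix T assume T: "T \<subseteq> U - Q" "T \<noteq> {} \<and> T \<noteq> U - Q"
    \<comment> \<open>A set avoiding \<open>x\<close> has no link to the component \<open>Q\<close>,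
      so its link to the rest of \<open>U\<close> stays outside \<open>Q\<close>. Sets containing
      \<open>x\<close> are handled through their complements.\<close>
    have key: "linked D T (U - Q - T)" if T: "T \<subseteq> U - Q" "T \<noteq> {}" "x \<notin> T" for T
    proof -
      have "linked D T (U - T)" using T x(1) by (intro connD[OF U(2)]) auto
      moreover have "U - T = (U - Q - T) \<union> Q" using T Q(1) by (auto simp: F_def)
      moreover have "\<not> linked D T Q"
        using nl linked_mono[of D T Q "U - {x} - Q" Q] linked_commute T by blast
      ultimately show ?thesis using linked_Un by metis
    qed
    show "linked D T (U - Q - T)"
    proof (cases "x \<in> T")
      case False
      then show ?thesis using key T by blast
    next
      case True
      then have "linked D (U - Q - T) (U - Q - (U - Q - T))" using key[of "U - Q - T"] T by blast
      moreover have "U - Q - (U - Q - T) = T" using T by blast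
      ultimately show ?thesis using linked_commute by metis
    qed
  qed
  have "head D a \<notin> U - Q" if "a \<in> arcs D" "tail D a \<in> Q" for a
  proof
    assume h: "head D a \<in> U - Q"
    have "tail D a \<in> U" using that Q(1) by (auto simp: F_def)
    then have "head D a \<noteq> x" using x(2) that by auto
    then have "linked D Q (U - {x} - Q)" using that h by (intro linkedI[of a D West]) auto
    then show False using nl by blast
  qed
  then have "splitting East D U (U - Q) Q"
    unfolding splitting_def using Q(1) x(1) cV by (auto simp: F_def)
  then show thesis by (rule that)
qed

section \<open>Pieces of a D-graph\<close>

text \<open>
  A piece is what successive cuts of \<open>D\<close> leave of it: \<open>U\<close> is its set of inner vertices, arcs keep their
  names, and every arc leaving \<open>U\<close> ends in a boundary vertex of its own, whose name is arbitrary.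
\<close>

locale piece =
  fixes D :: "('v, 'a) pre_digraph" and U :: "'v set" and G :: "('v, 'a) pre_digraph"
  assumes D: "D_graph D" and U: "U \<subseteq> inner_verts D" "U \<noteq> {}" "conn D U"
    and arcs: "arcs G = {a \<in> arcs D. \<exists>X. endp X D a \<in> U}"
    and verts: "verts G = U \<union> (\<Union>X. endp X G ` bnd X D U)"
    and endp_U: "\<And>X a. a \<in> arcs D \<Longrightarrow> endp X D a \<in> U \<Longrightarrow> endp X G a = endp X D a"
    and endp_bnd: "\<And>X a. a \<in> bnd X D U \<Longrightarrow> endp X G a \<notin> U"
    and inj: "\<And>X. inj_on (endp X G) (bnd X D U)"
    and sides: "\<And>X. endp X G ` bnd X D U \<inter> endp (opp X) G ` bnd (opp X) D U = {}"
begin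

lemma finite_U: "finite U"
  using finite_subset[OF U(1)] D_graphD(2)[OF D] by (auto simp: inner_verts_def)

lemma arc_cases:
  assumes "a \<in> arcs G"
  shows "endp X D a \<in> U \<and> endp X G a = endp X D a \<or> a \<in> bnd X D U \<and> endp X G a \<notin> U"
proof (cases "endp X D a \<in> U")
  case False
  obtain Y where "endp Y D a \<in> U" using assms arcs by blast
  then have "endp (opp X) D a \<in> U" using False side_cases[of Y X] by auto
  then have "a \<in> bnd X D U" using False assms by (auto simp: bnd_def arcs)
  then show ?thesis using endp_bnd by blast
qed (use assms endp_U arcs in auto)

lemma bnd_arcs: "a \<in> bnd X D U \<Longrightarrow> a \<in> arcs G"
  by (auto simp: bnd_def arcs)

lemma anchor: "a \<in> bnd X D U \<Longrightarrow> endp (opp X) G a = endp (opp X) D a \<and> endp (opp X) D a \<in> U"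
  using endp_U by (auto simp: bnd_def)

text \<open>\<open>inj\<close> excludes a second arc on the same side and \<open>sides\<close> one
  on the other side: boundary vertices are leaves, whatever their names.\<close>

lemma leaf_unique:
  assumes a: "a \<in> bnd X D U" and b: "b \<in> arcs G" "endp Y G b = endp X G a"
  shows "Y = X \<and> b = a"
proof -
  have bY: "b \<in> bnd Y D U" using arc_cases[OF b(1), of Y] b(2) endp_bnd[OF a] by auto
  have "Y = X"
  proof (rule ccontr)
    assume "Y \<noteq> X"
    then have "Y = opp X" using side_cases by blast
    then show False using sides[of X] a b(2) bY by auto
  qed
  then show ?thesis using inj_onD[OF inj[of X] _ _ a] b(2) bY by auto
qed

lemma inner_arc: "x \<in> U \<Longrightarrow> \<exists>a \<in> arcs G. endp X G a = x"
  using inner_vertsD[of x D X] U(1) endp_U arcs by blast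

lemma side_verts_eq: "side_verts X G = endp X G ` bnd X D U"
proof
  show "side_verts X G \<subseteq> endp X G ` bnd X D U"
  proof
    fix v assume v: "v \<in> side_verts X G"
    then have "v \<notin> U" using inner_arc[of v "opp X"] by (auto simp: side_verts_def)
    moreover have "v \<in> verts G" using v by (simp add: side_verts_def)
    ultimately obtain Y a where a: "a \<in> bnd Y D U" "v = endp Y G a" by (auto simp: verts)
    moreover have "Y \<noteq> opp X" using v a bnd_arcs by (auto simp: side_verts_def)
    then have "Y = X" using side_cases by blast
    ultimately show "v \<in> endp X G ` bnd X D U" by blast
  qed
  show "endp X G ` bnd X D U \<subseteq> side_verts X G"
  proof
    fix v assume "v \<in> endp X G ` bnd X D U"
    then obtain a where a: "a \<in> bnd X D U" "v = endp X G a" by blast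
    have "v \<noteq> endp (opp X) G b" if "b \<in> arcs G" for b
      using leaf_unique[OF a(1) that, of "opp X"] a(2) opp_neq[of X] by metis
    moreover have "v \<in> verts G" using a by (auto simp: verts)
    ultimately show "v \<in> side_verts X G" unfolding side_verts_def by blast
  qed
qed

lemma inner_verts_eq: "inner_verts G = U"
proof -
  have "(\<Union>X. endp X G ` bnd X D U) = side_verts West G \<union> side_verts East G"
    unfolding side_verts_eq by (simp add: UNIV_side)
  moreover have "side_verts X G \<inter> U = {}" for X using endp_bnd by (auto simp: side_verts_eq)
  ultimately show ?thesis unfolding inner_verts_def verts by blast
qed

lemma endp_verts: "a \<in> arcs G \<Longrightarrow> endp X G a \<in> verts G"
  using arc_cases[of a X] by (auto simp: verts)

lemma wf_digraph: "wf_digraph G"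
  using endp_verts[of _ West] endp_verts[of _ East] by (auto simp: wf_digraph_def)

text \<open>Every vertex on a cycle is both a head and a tail, which no boundary vertex is. So
  cycles stay in \<open>U\<close>, where the arcs are those of \<open>D\<close>.\<close>

lemma acyclic: "acyclic (arcs_ends G)"
proof (rule acyclicI, intro allI notI)
  have arc_in_D: "(x, y) \<in> arcs_ends D" if xy: "(x, y) \<in> arcs_ends G" "x \<in> U" "y \<in> U" for x y
  proof -
    obtain a where a: "a \<in> arcs G" "x = endp West G a" "y = endp East G a"
      using xy(1) by (auto simp: arcs_ends_conv)
    have "x = endp West D a" "y = endp East D a"
      using arc_cases[OF a(1), of West] arc_cases[OF a(1), of East] xy a by auto
    then show ?thesis using a(1) by (auto simp: arcs arcs_ends_conv)
  qed
  have mid: "y \<in> U" if yz: "(y, z) \<in> arcs_ends G" "(x, y) \<in> arcs_ends G" for x y z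
  proof -
    obtain a b where ab: "a \<in> arcs G" "b \<in> arcs G" "y = endp West G a" "y = endp East G b"
      using yz by (auto simp: arcs_ends_conv)
    then show ?thesis using arc_cases[OF ab(1), of West] leaf_unique[of a West b East] by auto
  qed
  have path: "z \<in> U \<Longrightarrow> (x, z) \<in> (arcs_ends D)\<^sup>+" if "(x, z) \<in> (arcs_ends G)\<^sup>+" "x \<in> U" for x z
    using that
  proof (induction rule: trancl_induct)
    case (step y z)
    have "y \<in> U" using step.hyps mid by (meson tranclD2)
    then show ?case using step arc_in_D by (meson trancl.trancl_into_trancl)
  qed (use arc_in_D in auto)
  fix x assume x: "(x, x) \<in> (arcs_ends G)\<^sup>+"
  then have "x \<in> U" using mid by (meson tranclD tranclD2)
  then show False using path[OF x] D_graphD(4)[OF D] by (auto simp: acyclic_def)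
qed

lemma WE_functional: "WE_functional G"
  unfolding WE_functional_def
proof (intro allI ballI impI)
  fix X a b assume a: "a \<in> side_arcs X G" and b: "b \<in> arcs G" "b \<noteq> a"
  obtain c where c: "c \<in> bnd X D U" "endp X G a = endp X G c"
    using a by (auto simp: side_arcs_def side_verts_eq)
  have "a = c" using leaf_unique[OF c(1) _ c(2)] a by (auto simp: side_arcs_def)
  then show "endp X G a \<noteq> endp X G b" using leaf_unique[OF c(1) b(1), of X] b(2) by auto
qed

lemma linked_iff:
  assumes "S \<subseteq> U" "T \<subseteq> U" shows "linked G S T \<longleftrightarrow> linked D S T"
proof
  assume "linked G S T"
  then obtain a X where a: "a \<in> arcs G" "endp X G a \<in> S" "endp (opp X) G a \<in> T" unfolding linked_def by blast
  then show "linked D S T"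
    using arc_cases[OF a(1), of X] arc_cases[OF a(1), of "opp X"] assms arcs
    by (intro linkedI[of a D X]) auto
next
  assume "linked D S T"
  then obtain a X where a: "a \<in> arcs D" "endp X D a \<in> S" "endp (opp X) D a \<in> T" unfolding linked_def by blast
  then show "linked G S T" using endp_U[of a X] endp_U[of a "opp X"] assms arcs
    by (intro linkedI[of a G X]) auto
qed

lemma conn_iff: "S \<subseteq> U \<Longrightarrow> conn G S \<longleftrightarrow> conn D S"
  unfolding conn_def using linked_iff by (metis Diff_subset subset_trans)

lemma linked_leaf:
  assumes "a \<in> bnd X D U" shows "linked G {endp (opp X) D a} {endp X G a}"
  using linkedI[of a G "opp X"] anchor[OF assms] bnd_arcs[OF assms] by auto

lemma linked_leafD:
  assumes a: "a \<in> bnd X D U" and l: "linked G {endp X G a} T" shows "endp (opp X) D a \<in> T"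
proof -
  obtain b Y where b: "b \<in> arcs G" "endp Y G b = endp X G a" "endp (opp Y) G b \<in> T"
    using l unfolding linked_def by blast
  then show ?thesis using leaf_unique[OF a b(1,2)] anchor[OF a] by auto
qed

lemma conn_verts: "conn G (verts G)"
  unfolding verts
proof (rule conn_Un_pendant)
  show "conn G U" using conn_iff U(3) by blast
  fix v assume "v \<in> (\<Union>X. endp X G ` bnd X D U)"
  then obtain X a where a: "a \<in> bnd X D U" "v = endp X G a" by blast
  from linked_leaf[OF a(1)] show "linked G U {v}"
    by (rule linked_mono) (use anchor[OF a(1)] a(2) in auto)
qed

lemma D_graph: "D_graph G"
proof -
  have "finite (arcs G)" using D_graphD(3)[OF D] by (simp add: arcs)
  moreover have "finite (verts G)"
    unfolding verts using finite_U D_graphD(3)[OF D]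
    by (simp add: UNIV_side bnd_def)
  ultimately show ?thesis
    using wf_digraph acyclic_digraphI[OF acyclic] WE_functional conn_verts U(2)
    unfolding D_graph_def fin_digraph_def fin_digraph_axioms_def
    by (auto simp: weakly_connected_iff_conn inner_verts_eq)
qed

section \<open>Grounded lists of a piece in terms of arcs\<close>

lemma conn_remove_leaves:
  assumes S: "conn G S" shows "conn D (S \<inter> U)"
proof -
  have "conn G (S \<inter> U)"
  proof (rule conn_remove_pendant[OF S])
    fix X Y a b assume ab: "a \<in> arcs G" "b \<in> arcs G" "endp X G a \<in> S - U" "endp Y G b = endp X G a"
    then have "a \<in> bnd X D U" using arc_cases[of a X] by auto
    then have "Y = X \<and> b = a" using leaf_unique ab by blast
    then show "endp (opp Y) G b = endp (opp X) G a" by simp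
  qed
  then show ?thesis using conn_iff[of "S \<inter> U"] by blast
qed

lemma conn_anchor:
  assumes S: "conn G S" "endp X G a \<in> S" "S \<noteq> {endp X G a}" and a: "a \<in> bnd X D U"
  shows "endp (opp X) D a \<in> S"
  using connD[OF S(1), of "{endp X G a}"] S linked_leafD[OF a] by blast

text \<open>Semipaths run between leaves while crossings live in \<open>U\<close>. Attaching the
  leaves to \<open>P\<close> and \<open>Q\<close> gives two disjoint semipaths; removing them from
  two disjoint semipaths leaves connected sets to which \<open>crossingI\<close> applies.\<close>

lemma separates_iff:
  assumes a: "a \<in> bnd X D U" and b: "b \<in> bnd X D U" and c: "c \<in> bnd X D U"
    and abc: "a \<noteq> b" "b \<noteq> c" "a \<noteq> c"
  shows "separates X G (endp X G a) (endp X G b) (endp X G c) \<longleftrightarrow> \<not> crossing X D U a b c"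
proof
  let ?f = "endp X G"
  have leaf: "?f a \<noteq> ?f c" "?f b \<noteq> ?f a" "?f b \<noteq> ?f c"
    using inj_onD[OF inj[of X]] a b c abc by blast+
  assume sep: "separates X G (?f a) (?f b) (?f c)"
  show "\<not> crossing X D U a b c"
  proof
    assume "crossing X D U a b c"
    then obtain P Q d where PQ: "P \<union> Q = U" "P \<inter> Q = {}" "conn D P" "conn D Q"
      "endp (opp X) D a \<in> P" "endp (opp X) D c \<in> P" "endp (opp X) D b \<in> Q"
      and d: "d \<in> bnd (opp X) D U" "endp X D d \<in> Q"
      unfolding crossing_def by blast
    let ?l = "endp (opp X) G d"
    have add: "conn G (S \<union> {endp Y G x})" if "conn G S" "x \<in> bnd Y D U" "endp (opp Y) D x \<in> S" for S Y x
      using conn_insert[OF that(1)] linked_mono[OF linked_leaf[OF that(2)]] that(3) by auto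
    have "conn G P" "conn G Q" using PQ conn_iff by blast+
    then have cP: "conn G (P \<union> {?f a} \<union> {?f c})" and cQ: "conn G (Q \<union> {?f b} \<union> {?l})"
      using add a b c d PQ(5-7) by auto
    have "?f a \<in> verts G" "?f b \<in> verts G" "?f c \<in> verts G" "?l \<in> verts G"
      using endp_verts bnd_arcs a b c d(1) by blast+
    then have sub: "P \<union> {?f a} \<union> {?f c} \<subseteq> verts G" "Q \<union> {?f b} \<union> {?l} \<subseteq> verts G"
      using PQ(1) by (auto simp: verts)
    obtain p where p: "p \<in> semipaths G (?f a) (?f c)" "set (fst p) \<subseteq> P \<union> {?f a} \<union> {?f c}"
      using conn_semipath[OF cP sub(1)] by blast
    obtain q where q: "q \<in> semipaths G (?f b) ?l" "set (fst q) \<subseteq> Q \<union> {?f b} \<union> {?l}"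
      using conn_semipath[OF cQ sub(2)] by blast
    have "?l \<in> side_verts (opp X) G" using d by (auto simp: side_verts_eq)
    then have "intersecting p q"
      using sep p q unfolding separates_def semipaths_to_side_def by blast
    moreover have "?l \<noteq> ?f a" "?l \<noteq> ?f c" using sides[of X] a c d(1) by blast+
    moreover have "?l \<notin> U" "?f a \<notin> U" "?f b \<notin> U" "?f c \<notin> U" using endp_bnd a b c d(1) by blast+
    ultimately show False
      using p(2) q(2) PQ(1,2) leaf unfolding intersecting_def by blast
  qed
next
  let ?f = "endp X G"
  have leaf: "?f a \<noteq> ?f c" using inj_onD[OF inj[of X]] a c abc by blast
  assume nc: "\<not> crossing X D U a b c"
  show "separates X G (?f a) (?f b) (?f c)"
    unfolding separates_def
  proof (intro ballI, rule ccontr)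
    fix p q assume p: "p \<in> semipaths G (?f a) (?f c)"
      and q': "q \<in> semipaths_to_side (opp X) G (?f b)" and ni: "\<not> intersecting p q"
    obtain d where d: "d \<in> bnd (opp X) D U" and q: "q \<in> semipaths G (?f b) (endp (opp X) G d)"
      using q' by (auto simp: semipaths_to_side_def side_verts_eq)
    note P = semipath_ends[OF p] and Q = semipath_ends[OF q]
    have lb: "?f b \<noteq> endp (opp X) G d" using sides[of X] b d by blast
    \<comment> \<open>Both semipaths have distinct ends, so neither consists of a single leaf, and
      each must pass through the anchors of its end leaves.\<close>
    have ne: "set (fst p) \<noteq> {?f a}" "set (fst p) \<noteq> {?f c}" "set (fst q) \<noteq> {?f b}"
      "set (fst q) \<noteq> {endp (opp X) G d}"
      using P(1,2) Q(1,2) leaf lb by auto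
    have mem: "endp (opp X) D a \<in> set (fst p) \<inter> U" "endp (opp X) D c \<in> set (fst p) \<inter> U"
      "endp (opp X) D b \<in> set (fst q) \<inter> U" "endp X D d \<in> set (fst q) \<inter> U"
      using conn_anchor[OF semipath_conn[OF P(3)] _ _ a] conn_anchor[OF semipath_conn[OF P(3)] _ _ c] P
        conn_anchor[OF semipath_conn[OF Q(3)] _ _ b] conn_anchor[OF semipath_conn[OF Q(3)] _ _ d] Q
        ne anchor[OF a] anchor[OF b] anchor[OF c] anchor[OF d] by auto
    have con: "conn D (set (fst p) \<inter> U)" "conn D (set (fst q) \<inter> U)"
      by (rule conn_remove_leaves, rule semipath_conn, fact)+
    have "set (fst p) \<inter> U \<inter> (set (fst q) \<inter> U) = {}" using ni by (auto simp: intersecting_def)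
    then have "crossing X D U a b c"
      by (rule crossingI[OF finite_U U(3) con(1) _ con(2) _ _ mem(1-3) d mem(4), rotated 2]) simp_all
    then show False using nc by blast
  qed
qed

lemma grounded_iff:
  assumes "set as = bnd X D U"
  shows "grounded X G (map (endp X G) as) \<longleftrightarrow> arc_grounded X D U as"
proof -
  let ?f = "endp X G"
  have i: "inj_on ?f (set as)" using inj assms by simp
  have "(\<forall>v u w. in_between (map ?f as) v u w \<longrightarrow> separates X G v u w) \<longleftrightarrow>
      (\<forall>a b c. in_between as a b c \<longrightarrow> \<not> crossing X D U a b c)" (is "?L \<longleftrightarrow> ?R")
  proof
    assume L: ?L
    show ?R
    proof (intro allI impI)
      fix a b c assume ib: "in_between as a b c"
      have "separates X G (?f a) (?f b) (?f c)" using L in_between_map[OF i ib] by blast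
      then show "\<not> crossing X D U a b c"
        using separates_iff[of a X b c] in_between_set[OF ib] ib assms by (auto simp: in_between_def)
    qed
  next
    assume R: ?R
    show ?L
    proof (intro allI impI)
      fix v u w assume ib: "in_between (map ?f as) v u w"
      obtain a b c where abc: "a \<in> set as" "b \<in> set as" "c \<in> set as" "v = ?f a" "u = ?f b" "w = ?f c"
        using in_between_set[OF ib] by auto
      then have ib': "in_between as a b c" using ib in_between_map_iff[OF i] by blast
      then have "\<not> crossing X D U a b c" using R by blast
      then show "separates X G v u w"
        using separates_iff[of a X b c] abc ib' assms by (auto simp: in_between_def)
    qed
  qed
  then show ?thesis
    unfolding grounded_def arc_grounded_def using i assms by (auto simp: distinct_map side_verts_eq)
qed

lemma grounded_arcs:
  assumes "grounded X G xs"
  obtains as where "xs = map (endp X G) as" "arc_grounded X D U as"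
proof -
  let ?g = "inv_into (bnd X D U) (endp X G)"
  have xs: "set xs = endp X G ` bnd X D U" using assms by (auto simp: grounded_def side_verts_eq)
  have m: "map (endp X G) (map ?g xs) = xs"
    using xs by (auto intro!: map_idI simp: f_inv_into_f)
  have "set (map ?g xs) = bnd X D U" using xs inj by (auto simp: inv_into_f_f image_image)
  then have "arc_grounded X D U (map ?g xs)" using grounded_iff assms m by metis
  then show thesis using that m by metis
qed

end

section \<open>Cutting a piece\<close>

lemma outer_endp_side:
  assumes "wf_digraph D" "a \<in> arcs D" "endp X D a \<notin> inner_verts D"
  shows "endp X D a \<in> side_verts X D"
proof (rule ccontr)
  have v: "endp X D a \<in> verts D" using assms(1,2) by (rule endp_in_verts)
  assume n: "endp X D a \<notin> side_verts X D"
  have "endp X D a \<notin> side_verts (opp X) D" using assms(2) by (auto simp: side_verts_def)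
  with n have "endp X D a \<notin> side_verts West D \<union> side_verts East D" by (cases X) auto
  then show False using v assms(3) by (simp add: inner_verts_def)
qed

lemma outer_arc_unique:
  assumes D: "D_graph D" and a: "a \<in> arcs D" "endp X D a \<notin> inner_verts D"
    and b: "b \<in> arcs D" "endp Y D b = endp X D a"
  shows "Y = X \<and> b = a"
proof -
  have s: "endp X D a \<in> side_verts X D" by (rule outer_endp_side[OF D_graphD(1)[OF D] a])
  have "Y \<noteq> opp X" using s b by (auto simp: side_verts_def)
  then have "Y = X" using side_cases by blast
  moreover have "a \<in> side_arcs X D" using s a by (simp add: side_arcs_def)
  ultimately show ?thesis using D_graphD(5)[OF D] b unfolding WE_functional_def by metis
qed

text \<open>If both ends were outer, no other arc could touch them by
  \<open>outer_arc_unique\<close>, and the arc would be cut off from the inner vertices.\<close>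

lemma arc_meets_inner:
  assumes D: "D_graph D" and a: "a \<in> arcs D" "endp X D a \<notin> inner_verts D"
  shows "endp (opp X) D a \<in> inner_verts D"
proof (rule ccontr)
  assume n: "endp (opp X) D a \<notin> inner_verts D"
  let ?T = "{endp X D a, endp (opp X) D a}"
  obtain v where v: "v \<in> inner_verts D" using D_graphD(7)[OF D] by blast
  have "v \<notin> ?T" "v \<in> verts D" using v a n by (auto simp: inner_verts_def)
  then have "linked D ?T (verts D - ?T)"
    using endp_in_verts[OF D_graphD(1)[OF D] a(1)] by (intro connD[OF D_graphD(6)[OF D]]) auto
  then obtain b Y where b: "b \<in> arcs D" "endp Y D b \<in> ?T" "endp (opp Y) D b \<notin> ?T"
    unfolding linked_def by blast
  then have "b = a" using outer_arc_unique[OF D a b(1)] outer_arc_unique[OF D a(1) n b(1)] by blast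
  then show False using b(3) side_cases[of "opp Y" X] by auto
qed

text \<open>The start of the induction: no cut has been made yet. Outer vertices are pendant, so
  removing them preserves connectedness.\<close>

lemma piece_inner_verts:
  assumes D: "D_graph D" shows "piece D (inner_verts D) D"
proof
  note d = D_graphD[OF D]
  show "D_graph D" "inner_verts D \<subseteq> inner_verts D" "inner_verts D \<noteq> {}" using D d by auto
  have "conn D (verts D \<inter> inner_verts D)"
  proof (rule conn_remove_pendant[OF d(6)])
    fix X Y a b assume "a \<in> arcs D" "b \<in> arcs D" "endp X D a \<in> verts D - inner_verts D" "endp Y D b = endp X D a"
    then have "Y = X \<and> b = a" using outer_arc_unique[OF D] by blast
    then show "endp (opp Y) D b = endp (opp X) D a" by simp
  qed
  moreover have sub: "inner_verts D \<subseteq> verts D" by (auto simp: inner_verts_def)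
  ultimately show "conn D (inner_verts D)" by (simp add: Int_absorb1)
  show "arcs D = {a \<in> arcs D. \<exists>X. endp X D a \<in> inner_verts D}"
    using arc_meets_inner[OF D, of _ West] by blast
  show "verts D = inner_verts D \<union> (\<Union>X. endp X D ` bnd X D (inner_verts D))"
  proof
    show "verts D \<subseteq> inner_verts D \<union> (\<Union>X. endp X D ` bnd X D (inner_verts D))"
    proof
      fix v assume v: "v \<in> verts D"
      show "v \<in> inner_verts D \<union> (\<Union>X. endp X D ` bnd X D (inner_verts D))"
      proof (cases "v \<in> inner_verts D")
        case False
        then have "linked D {v} (verts D - {v})" using v d(7) sub by (intro connD[OF d(6)]) auto
        then obtain a X where a: "a \<in> arcs D" "endp X D a = v" unfolding linked_def by blast
        then have "a \<in> bnd X D (inner_verts D)" using arc_meets_inner[OF D a(1)] False by (auto simp: bnd_def)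
        then show ?thesis using a by blast
      qed simp
    qed
  qed (use sub endp_in_verts[OF d(1)] in \<open>auto simp: bnd_def\<close>)
  fix X
  show "endp X D a \<notin> inner_verts D" if "a \<in> bnd X D (inner_verts D)" for a
    using that by (simp add: bnd_def)
  show "inj_on (endp X D) (bnd X D (inner_verts D))"
    using outer_arc_unique[OF D] by (intro inj_onI) (metis bndD)
  show "endp X D ` bnd X D (inner_verts D) \<inter> endp (opp X) D ` bnd (opp X) D (inner_verts D) = {}"
    using outer_arc_unique[OF D] opp_neq by (fastforce simp: bnd_def)
qed simp

definition cross_arcs :: "('v, 'a) pre_digraph \<Rightarrow> 'v set \<Rightarrow> 'v set \<Rightarrow> 'a set" where
  "cross_arcs D V V' = {a \<in> arcs D. tail D a \<in> V \<and> head D a \<in> V'}"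

text \<open>The candidate for the weak component at \<open>V\<close> once \<open>C\<close> is
  removed from \<open>G\<close>. It takes \<open>tail\<close> and \<open>head\<close> from
  \<open>G\<close> unchanged, as being a subgraph demands.\<close>

definition part :: "('v, 'a) pre_digraph \<Rightarrow> ('v, 'a) pre_digraph \<Rightarrow> 'a set \<Rightarrow> 'v set \<Rightarrow> ('v, 'a) pre_digraph" where
  "part D G C V =
     \<lparr>verts = V \<union> (\<Union>X. endp X G ` (bnd X D V - C)), arcs = {a \<in> arcs D. \<exists>X. endp X D a \<in> V} - C,
      tail = tail G, head = head G\<rparr>"

lemma endp_part [simp]: "endp X (part D G C V) = endp X G"
  by (cases X) (auto simp: part_def)

lemma arcs_part_eq: "arcs (part D G C V) = {a \<in> arcs D. \<exists>X. endp X D a \<in> V} - C"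
  by (simp add: part_def)

locale piece_splitting = piece D U G for D :: "('v, 'a) pre_digraph" and U G +
  fixes V V' C
  assumes split: "splitting East D U V V'"
  defines "C \<equiv> cross_arcs D V V'"
begin

lemmas S = splittingD[OF split]

lemma V_sub: "V \<subseteq> U" "V' \<subseteq> U"
  using S(1) by auto

lemma no_back: "a \<in> arcs D \<Longrightarrow> tail D a \<in> V' \<Longrightarrow> head D a \<notin> V"
  using S(7) by simp

lemma C_D: "a \<in> C \<Longrightarrow> a \<in> arcs D \<and> tail D a \<in> V \<and> head D a \<in> V'"
  by (simp add: C_def cross_arcs_def)

lemma C_arcs: "C \<subseteq> {a \<in> arcs D. \<exists>X. endp X D a \<in> V}" "C \<subseteq> {a \<in> arcs D. \<exists>X. endp X D a \<in> V'}"
  using C_D by (auto intro: exI[of _ West] exI[of _ East])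

lemma C_bnd: "C \<subseteq> bnd East D V" "C \<subseteq> bnd West D V'" "C \<inter> bnd West D V = {}" "C \<inter> bnd East D V' = {}"
  using C_D S(2) by (auto simp: bnd_def)

lemma C_nonempty: "C \<noteq> {}"
proof -
  obtain a where "a \<in> arcs D" "endp (opp East) D a \<in> V" "endp East D a \<in> V'"
    using splitting_linked_arc[OF split splitting_linked[OF split U(3)]] by blast
  then show ?thesis by (auto simp: C_def cross_arcs_def)
qed

lemma C_inner: "C \<inter> bnd X D U = {}"
  using C_D V_sub by (cases X) (auto simp: bnd_def)

lemma bnd_V: "bnd X D V - C = {a \<in> bnd X D U. endp (opp X) D a \<in> V}"
proof (cases X)
  case East
  then show ?thesis using S(1,2) C_inner[of X] V_sub by (auto simp: bnd_def C_def cross_arcs_def)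
next
  case West
  then show ?thesis using S(1,2) C_inner[of X] V_sub no_back by (auto simp: bnd_def C_def cross_arcs_def)
qed

lemma bnd_V': "bnd X D V' - C = {a \<in> bnd X D U. endp (opp X) D a \<in> V'}"
proof (cases X)
  case East
  then show ?thesis using S(1,2) C_inner[of X] V_sub no_back by (auto simp: bnd_def C_def cross_arcs_def)
next
  case West
  then show ?thesis using S(1,2) C_inner[of X] V_sub by (auto simp: bnd_def C_def cross_arcs_def)
qed

lemma verts_part: "verts (part D G C V) \<union> verts (part D G C V') = verts G"
proof -
  have "bnd X D U = (bnd X D V - C) \<union> (bnd X D V' - C)" for X
    unfolding bnd_V bnd_V' using S(1) by (auto simp: bnd_def)
  then show ?thesis unfolding part_def verts using S(1) by auto
qed

lemma verts_part_disjoint: "verts (part D G C V) \<inter> verts (part D G C V') = {}"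
proof -
  have "endp X G a \<noteq> endp Y G b"
    if a: "a \<in> bnd X D U" "endp (opp X) D a \<in> V" and b: "b \<in> bnd Y D U" "endp (opp Y) D b \<in> V'" for X Y a b
  proof
    assume "endp X G a = endp Y G b"
    then have "Y = X \<and> b = a" using leaf_unique[OF a(1) bnd_arcs[OF b(1)]] by simp
    then show False using a(2) b(2) S(2) by auto
  qed
  then show ?thesis
    unfolding part_def bnd_V bnd_V' using S(2) V_sub endp_bnd by simp blast
qed

lemma arcs_part: "arcs (part D G C V) \<union> arcs (part D G C V') \<union> C = arcs G"
  "arcs (part D G C V) \<inter> arcs (part D G C V') = {}"
proof -
  show "arcs (part D G C V) \<union> arcs (part D G C V') \<union> C = arcs G"
    using S(1) C_arcs by (auto simp: part_def arcs)
  show "arcs (part D G C V) \<inter> arcs (part D G C V') = {}"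
  proof (rule ccontr)
    assume "arcs (part D G C V) \<inter> arcs (part D G C V') \<noteq> {}"
    then obtain a X Y where a: "a \<in> arcs D" "a \<notin> C" "endp X D a \<in> V" "endp Y D a \<in> V'"
      by (auto simp: part_def)
    then show False using S(2) no_back[OF a(1)]
      by (cases X; cases Y) (auto simp: C_def cross_arcs_def)
  qed
qed

text \<open>Treats both halves of the cut at once: \<open>Y\<close> is the side on which the arcs of
  \<open>C\<close> receive their new ends.\<close>

lemma piece_restrict:
  assumes W: "W = V \<and> Y = East \<or> W = V' \<and> Y = West"
    and \<nu>: "inj_on \<nu> C" "\<nu> ` C \<inter> verts G = {}"
    and arcs': "arcs G' = arcs (part D G C W) \<union> C" and verts': "verts G' = verts (part D G C W) \<union> \<nu> ` C"
    and endp': "\<And>a. a \<in> C \<Longrightarrow> endp Y G' a = \<nu> a" "\<And>a. a \<notin> C \<Longrightarrow> endp Y G' a = endp Y G a"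
      "\<And>a. endp (opp Y) G' a = endp (opp Y) G a"
  shows "piece D W G'"
proof -
  have W_sub: "W \<subseteq> U" "W \<noteq> {}" "conn D W" using W V_sub S by auto
  have bW: "bnd X D W - C = {a \<in> bnd X D U. endp (opp X) D a \<in> W}" for X using W bnd_V bnd_V' by auto
  have CW: "C \<subseteq> bnd Y D W" "C \<inter> bnd (opp Y) D W = {}" using W C_bnd by auto
  have eq: "endp X G' a = endp X G a" if "X \<noteq> Y \<or> a \<notin> C" for X a
    using that endp' side_cases[of X Y] by auto
  have \<nu>V: "\<nu> a \<notin> verts G" if "a \<in> C" for a using that \<nu>(2) by blast
  have bG: "endp X G' a = endp X G a \<and> a \<in> bnd X D U \<or> X = Y \<and> a \<in> C \<and> endp X G' a = \<nu> a"
    if "a \<in> bnd X D W" for X a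
  proof (cases "a \<in> C")
    case True
    then have "X = Y" using that CW side_cases by blast
    then show ?thesis using True endp'(1) by blast
  next
    case False
    then show ?thesis using that bW eq by blast
  qed
  have vb: "a \<in> bnd X D U \<Longrightarrow> endp X G a \<in> verts G" for a X by (auto simp: verts)
  show ?thesis
  proof
    show "D_graph D" "W \<subseteq> inner_verts D" "W \<noteq> {}" "conn D W" using D U(1) W_sub by auto
    show "arcs G' = {a \<in> arcs D. \<exists>X. endp X D a \<in> W}" using C_arcs W by (auto simp: arcs' part_def)
    have "endp X G' ` bnd X D W = endp X G ` (bnd X D W - C) \<union> (if X = Y then \<nu> ` C else {})" for X
    proof (cases "X = Y")
      case True
      then have "bnd X D W = (bnd X D W - C) \<union> C" using CW by blast
      then have "endp X G' ` bnd X D W = endp X G' ` (bnd X D W - C) \<union> endp X G' ` C" by (metis image_Un)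
      also have "endp X G' ` C = \<nu> ` C" using True endp'(1) by (auto intro!: image_cong)
      also have "endp X G' ` (bnd X D W - C) = endp X G ` (bnd X D W - C)" using eq by (auto intro!: image_cong)
      finally show ?thesis using True by simp
    next
      case False
      then have "bnd X D W - C = bnd X D W" using CW side_cases[of X Y] by blast
      then show ?thesis using False eq by auto
    qed
    then show "verts G' = W \<union> (\<Union>X. endp X G' ` bnd X D W)"
      by (auto simp: verts' part_def split: if_splits)
    fix X
    show "endp X G' a = endp X D a" if "a \<in> arcs D" "endp X D a \<in> W" for a
    proof -
      have "X \<noteq> Y \<or> a \<notin> C" using that CW(1) by (auto simp: bnd_def)
      then show ?thesis using eq endp_U that W_sub(1) by auto
    qed
    show "endp X G' a \<notin> W" if "a \<in> bnd X D W" for a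
    proof -
      have "W \<subseteq> verts G" using W_sub(1) by (auto simp: verts)
      then show ?thesis using bG[OF that] endp_bnd[of a X] \<nu>V[of a] W_sub(1) by auto
    qed
    show "inj_on (endp X G') (bnd X D W)"
    proof (rule inj_onI)
      fix a b assume a: "a \<in> bnd X D W" and b: "b \<in> bnd X D W" and e: "endp X G' a = endp X G' b"
      show "a = b"
        using bG[OF a] bG[OF b] e inj_onD[OF inj[of X]] inj_onD[OF \<nu>(1)] vb[of a X] vb[of b X] \<nu>V[of a] \<nu>V[of b]
        by metis
    qed
    show "endp X G' ` bnd X D W \<inter> endp (opp X) G' ` bnd (opp X) D W = {}"
    proof (rule ccontr)
      assume "endp X G' ` bnd X D W \<inter> endp (opp X) G' ` bnd (opp X) D W \<noteq> {}"
      then obtain a b where a: "a \<in> bnd X D W" and b: "b \<in> bnd (opp X) D W"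
        and e: "endp X G' a = endp (opp X) G' b" by blast
      show False
        using bG[OF a] bG[OF b] e leaf_unique[of a X b "opp X"] bnd_arcs[of b "opp X"] vb[of a X] vb[of b "opp X"]
          \<nu>V[of a] \<nu>V[of b] opp_neq[of X] by metis
    qed
  qed
qed

end

locale piece_cut = piece_splitting D U G V V' C for D :: "('v, 'a) pre_digraph" and U G V V' C +
  fixes \<nu> :: "'a \<Rightarrow> 'v"
  assumes \<nu>: "inj_on \<nu> C" "\<nu> ` C \<inter> verts G = {}"
begin

abbreviation "GW \<equiv> cut_W G C (part D G C V) \<nu>"
abbreviation "GE \<equiv> cut_E G C (part D G C V') \<nu>"

lemma piece_W: "piece D V GW"
  by (rule piece_restrict[OF _ \<nu>, of _ East]) (auto simp: cut_W_def)

lemma piece_E: "piece D V' GE"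
  by (rule piece_restrict[OF _ \<nu>, of _ West]) (auto simp: cut_E_def)

lemma arcs_Int: "arcs GW \<inter> arcs GE = C"
  using arcs_part(2) by (auto simp: cut_W_def cut_E_def)

lemma juncture_verts_eq: "juncture_verts GW GE = \<nu> ` C"
  unfolding juncture_verts_def arcs_Int by (auto simp: cut_W_def)

lemma verts_Int: "verts GW \<inter> verts GE = \<nu> ` C"
  using verts_part_disjoint verts_part \<nu>(2) by (auto simp: cut_W_def cut_E_def)

text \<open>An equality of records, including the values of \<open>tail\<close> and
  \<open>head\<close> outside the arcs, so the induction reaches \<open>G\<close> itself and not
  just an isomorphic copy.\<close>

lemma juncture_eq: "juncture GW GE = G"
proof (rule pre_digraph.equality)
  have "verts GW \<union> verts GE = verts G \<union> \<nu> ` C"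
    using verts_part by (auto simp: cut_W_def cut_E_def)
  then show "verts (juncture GW GE) = verts G"
    using \<nu>(2) juncture_verts_eq by (auto simp: juncture_def)
  show "arcs (juncture GW GE) = arcs G"
    using arcs_part(1) by (auto simp: juncture_def cut_W_def cut_E_def)
  show "tail (juncture GW GE) = tail G" "head (juncture GW GE) = head G"
    by (auto simp: juncture_def cut_W_def cut_E_def)
qed simp

lemma juncture_defined: "juncture_defined GW GE"
  unfolding juncture_defined_def arcs_Int verts_Int juncture_verts_eq
proof (intro conjI ballI refl C_nonempty)
  show "D_graph GW" "D_graph GE" by (rule piece.D_graph, rule piece_W piece_E)+
  fix a assume a: "a \<in> C"
  show "head GW a = tail GE a" using a by (simp add: cut_W_def cut_E_def)
  have "endp East GW a \<in> side_verts East GW" "endp West GE a \<in> side_verts West GE"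
    using a C_bnd unfolding piece.side_verts_eq[OF piece_W] piece.side_verts_eq[OF piece_E] by blast+
  then show "a \<in> side_arcs East GW" "a \<in> side_arcs West GE"
    using a by (auto simp: side_arcs_def cut_W_def cut_E_def)
qed

lemma P_compatible_iff: "P_compatible GW GE \<longleftrightarrow> arc_compatible East D V V'"
proof -
  let ?A = "bnd East D V \<union> bnd West D V'"
  \<comment> \<open>One naming of arcs by vertices for both halves; on \<open>C\<close> the two
    choices agree, both being \<nu>. Compatibility passes along \<open>h\<close> and its inverse
    once \<open>h\<close> is injective, and by \<open>mixed\<close> the halves share no other
    names.\<close>
  define h where "h a = (if a \<in> bnd East D V then endp East GW a else endp West GE a)" for a
  have C_int: "bnd East D V \<inter> bnd West D V' = C"
    using C_bnd S(2) by (auto simp: bnd_def C_def cross_arcs_def)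
  have hW: "h a = endp East GW a" if "a \<in> bnd East D V" for a using that by (simp add: h_def)
  have hE: "h a = endp West GE a" if "a \<in> bnd West D V'" for a
    using that C_int by (auto simp: h_def cut_W_def cut_E_def)
  have mixed: "a = b" if a: "a \<in> bnd East D V" and b: "b \<in> bnd West D V'"
    and e: "endp East GW a = endp West GE b" for a b
  proof -
    have "endp East GW a \<in> verts GW \<inter> verts GE"
      using piece.endp_verts[OF piece_W piece.bnd_arcs[OF piece_W a], of East]
        piece.endp_verts[OF piece_E piece.bnd_arcs[OF piece_E b], of West] e by simp
    then obtain c where c: "c \<in> C" "endp East GW a = \<nu> c" unfolding verts_Int by blast
    then have "endp East GW a = endp East GW c" "endp West GE b = endp West GE c"
      using e by (auto simp: cut_W_def cut_E_def)
    then show ?thesis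
      using inj_onD[OF piece.inj[OF piece_W, of East] _ a, of c]
        inj_onD[OF piece.inj[OF piece_E, of West] _ b, of c] c(1) C_bnd by auto
  qed
  have inj_h: "inj_on h ?A"
  proof (rule inj_onI)
    fix a b assume ab: "a \<in> ?A" "b \<in> ?A" "h a = h b"
    then consider "a \<in> bnd East D V" "b \<in> bnd East D V" | "a \<in> bnd West D V'" "b \<in> bnd West D V'"
      | "a \<in> bnd East D V" "b \<in> bnd West D V'" | "b \<in> bnd East D V" "a \<in> bnd West D V'" by blast
    then show "a = b"
    proof cases
      case 1
      then show ?thesis using ab(3) hW inj_onD[OF piece.inj[OF piece_W, of East]] by simp
    next
      case 2
      then show ?thesis using ab(3) hE inj_onD[OF piece.inj[OF piece_E, of West]] by simp
    next
      case 3
      then show ?thesis using ab(3) hW hE mixed by simp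
    next
      case 4
      then show ?thesis using ab(3) hW hE mixed[of b a] by simp
    qed
  qed
  show ?thesis
  proof
    assume "P_compatible GW GE"
    then obtain xs ys where xs: "grounded East GW xs" and ys: "grounded West GE ys" and c: "compatible_lists xs ys"
      unfolding P_compatible_def by blast
    obtain as where as: "xs = map (endp East GW) as" "arc_grounded East D V as"
      by (rule piece.grounded_arcs[OF piece_W xs])
    obtain bs where bs: "ys = map (endp West GE) bs" "arc_grounded West D V' bs"
      by (rule piece.grounded_arcs[OF piece_E ys])
    note as' = arc_groundedD(2)[OF as(2)] and bs' = arc_groundedD(2)[OF bs(2)]
    have "xs = map h as" "ys = map h bs" using as(1) bs(1) as' bs' hW hE by auto
    moreover have "inj_on (inv_into ?A h) (set (map h as) \<union> set (map h bs))"
      using as' bs' by (intro inj_on_inv_into) auto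
    ultimately have "compatible_lists (map (inv_into ?A h) (map h as)) (map (inv_into ?A h) (map h bs))"
      using compatible_lists_map c by blast
    moreover have "map (inv_into ?A h) (map h as) = as" "map (inv_into ?A h) (map h bs) = bs"
      using as' bs' inj_h by (auto intro!: map_idI)
    ultimately show "arc_compatible East D V V'"
      using as(2) bs(2) unfolding arc_compatible_def by auto
  next
    assume "arc_compatible East D V V'"
    then obtain as bs where as: "arc_grounded East D V as" and bs: "arc_grounded West D V' bs"
      and c: "compatible_lists as bs"
      unfolding arc_compatible_def by auto
    note as' = arc_groundedD(2)[OF as] and bs' = arc_groundedD(2)[OF bs]
    have "compatible_lists (map h as) (map h bs)"
      using compatible_lists_map[OF c] inj_h as' bs' by simp
    moreover have "map h as = map (endp East GW) as" "map h bs = map (endp West GE) bs"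
      using as' bs' hW hE by auto
    ultimately show "P_compatible GW GE"
      using piece.grounded_iff[OF piece_W as'] piece.grounded_iff[OF piece_E bs'] as bs juncture_defined
      unfolding P_compatible_def by metis
  qed
qed

end

section \<open>The induction over pieces\<close>

lemma fresh_inj:
  assumes "finite C" "finite V"
  obtains \<nu> :: "'a \<Rightarrow> 'v::infinite" where "inj_on \<nu> C" "\<nu> ` C \<inter> V = {}"
proof -
  have "infinite (UNIV - V)" using assms(2) infinite_UNIV by (simp add: Diff_infinite_finite)
  then obtain B where B: "B \<subseteq> UNIV - V" "finite B" "card B = card C"
    using infinite_arbitrarily_large by blast
  then obtain \<nu> where "bij_betw \<nu> C B" using finite_same_card_bij assms(1) by metis
  then show thesis using that[of \<nu>] B(1) by (auto simp: bij_betw_def)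
qed

text \<open>\<open>D\<close> stays fixed while \<open>U\<close> and \<open>G\<close> vary; as the
  hypothesis mentions \<open>U\<close> only, the choice of new vertices in a cut does not affect
  it.\<close>

lemma piece_P2_graph:
  fixes D G :: "('v::infinite, 'a) pre_digraph"
  assumes "piece D U G" "all_splittings_compatible D U"
  shows "P2_graph G"
  using assms
proof (induction "card U" arbitrary: U G rule: less_induct)
  case less
  interpret piece D U G by fact
  show ?case
  proof (cases "\<exists>x. U \<subseteq> {x}")
    case True
    then have "\<exists>!x. x \<in> inner_verts G" using U(2) unfolding inner_verts_eq by blast
    then have "basic_D_graph G" using D_graph by (simp add: basic_D_graph_def)
    then show ?thesis by (rule P2_graph.basic)
  next
    case False
    obtain V V' where split: "splitting East D U V V'"
      by (rule splitting_exists[OF D finite_U U(3) False])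
    let ?C = "cross_arcs D V V'"
    have "finite ?C" using D_graphD(3)[OF D] by (simp add: cross_arcs_def)
    moreover have "finite (verts G)" using D_graphD(2)[OF D_graph] .
    ultimately obtain \<nu> where "inj_on \<nu> ?C" "\<nu> ` ?C \<inter> verts G = {}" by (rule fresh_inj)
    then interpret piece_cut D U G V V' ?C \<nu> by unfold_locales (use split in simp_all)
    have out: "bnd X D W \<noteq> {}" if "W \<subseteq> U" "W \<noteq> {}" for X W
      using bnd_nonempty[OF D] that U(1) by blast
    have all: "all_splittings_compatible D V" "all_splittings_compatible D V'"
      using all_splittings_compatible_hereditary[OF finite_U U(3) less.prems(2) out] split
        splitting_commute[of East D U V V'] by blast+
    have card: "card V < card U" "card V' < card U"
      using S finite_U by (auto intro!: psubset_card_mono)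
    have "P2_graph GW" "P2_graph GE"
      using less.hyps card piece_W piece_E all by blast+
    moreover have "P_compatible GW GE"
      using less.prems(2) split unfolding P_compatible_iff all_splittings_compatible_def by blast
    ultimately have "P2_graph (juncture GW GE)" by (rule P2_graph.junct)
    then show ?thesis by (simp add: juncture_eq)
  qed
qed

section \<open>Cocycles from splittings\<close>

text \<open>\<open>H\<close> contains every arc of \<open>R\<close> that touches it, so a connected
  subgraph meeting \<open>H\<close> has no arc by which to leave it.\<close>

lemma closed_subgraph_absorbs:
  assumes H: "subgraph H R" "\<forall>a \<in> arcs R. \<forall>X. endp X R a \<in> verts H \<longrightarrow> a \<in> arcs H"
    and K: "subgraph K R" "weakly_connected K" "verts K \<inter> verts H \<noteq> {}"
  shows "subgraph K H"
proof -
  have endp: "endp X H = endp X R" "endp X K = endp X R" for X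
    using H(1) K(1) by (cases X; auto simp: subgraph_def compatible_def)+
  have wf: "wf_digraph H" "wf_digraph K" using H(1) K(1) by (auto simp: subgraph_def)
  have sub: "arcs K \<subseteq> arcs R" using K(1) by (simp add: subgraph_def)
  have V: "verts K \<subseteq> verts H"
  proof (rule ccontr)
    assume "\<not> verts K \<subseteq> verts H"
    then have "linked K (verts K \<inter> verts H) (verts K - verts K \<inter> verts H)"
      using K(2,3) by (intro connD[of K "verts K"]) (auto simp: weakly_connected_iff_conn)
    then obtain a X where a: "a \<in> arcs K" "endp X K a \<in> verts H" "endp (opp X) K a \<notin> verts H"
      unfolding linked_def by blast
    then have "a \<in> arcs H" using H(2) sub endp by auto
    then show False using endp_in_verts[OF wf(1), of a "opp X"] a(3) endp by simp
  qed
  moreover have "arcs K \<subseteq> arcs H"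
  proof
    fix a assume a: "a \<in> arcs K"
    then have "endp West R a \<in> verts H" using endp_in_verts[OF wf(2) a, of West] V endp by auto
    then show "a \<in> arcs H" using H(2) a sub by blast
  qed
  ultimately show ?thesis using H(1) K(1) by (auto simp: subgraph_def compatible_def)
qed

lemma subgraph_antisymmetric: "subgraph H K \<Longrightarrow> subgraph K H \<Longrightarrow> H = (K :: ('v, 'a) pre_digraph)"
  by (intro pre_digraph.equality) (auto simp: subgraph_def compatible_def)

lemma closed_subgraph_weak_component:
  assumes H: "subgraph H R" "\<forall>a \<in> arcs R. \<forall>X. endp X R a \<in> verts H \<longrightarrow> a \<in> arcs H"
    and ne: "verts H \<noteq> {}" and c: "weakly_connected H"
  shows "H \<in> weak_components R"
    "\<And>K. K \<in> weak_components R \<Longrightarrow> verts K \<inter> verts H \<noteq> {} \<Longrightarrow> K = H"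
proof -
  have "H' = H" if "subgraph H H'" "subgraph H' R" "weakly_connected H'" for H'
  proof -
    have "verts H' \<inter> verts H \<noteq> {}" using that(1) ne by (auto simp: subgraph_def)
    then show ?thesis using closed_subgraph_absorbs[OF H that(2,3)] that(1) subgraph_antisymmetric by blast
  qed
  then show "H \<in> weak_components R"
    using H(1) ne c unfolding weak_components_def pre_digraph.max_subgraph_def by blast
  fix K assume K: "K \<in> weak_components R" "verts K \<inter> verts H \<noteq> {}"
  then have "subgraph K H"
    using closed_subgraph_absorbs[OF H] unfolding weak_components_def pre_digraph.max_subgraph_def by blast
  moreover have "\<And>H'. H' \<noteq> K \<Longrightarrow> subgraph K H' \<Longrightarrow> subgraph H' R \<Longrightarrow> \<not> weakly_connected H'"
    using K(1) by (simp add: weak_components_def pre_digraph.max_subgraph_def)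
  ultimately show "K = H" using H(1) c by metis
qed

context piece_splitting
begin

lemma wf_part:
  assumes W: "W = V \<or> W = V'" shows "wf_digraph (part D G C W)"
proof -
  have "endp X G a \<in> verts (part D G C W)" if a: "a \<in> arcs (part D G C W)" for a X
  proof (cases "endp X D a \<in> W")
    case True
    then show ?thesis using endp_U a W V_sub by (auto simp: part_def)
  next
    case False
    obtain Y where "endp Y D a \<in> W" using a by (auto simp: part_def)
    then have "a \<in> bnd X D W - C" using False a side_cases[of Y X] by (auto simp: part_def bnd_def)
    then show ?thesis by (auto simp: part_def)
  qed
  from this[of _ West] this[of _ East] show ?thesis by (auto simp: wf_digraph_def part_def)
qed

lemma weakly_connected_part:
  assumes W: "W = V \<or> W = V'" shows "weakly_connected (part D G C W)"
proof -
  let ?H = "part D G C W"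
  have bW: "bnd X D W - C = {a \<in> bnd X D U. endp (opp X) D a \<in> W}" for X using W bnd_V bnd_V' by auto
  have sub: "W \<subseteq> U" "conn D W" using W V_sub S by auto
  have l: "linked ?H T T'" if lk: "linked D T T'" "T \<subseteq> W" "T' \<subseteq> W" for T T'
  proof -
    obtain a X where a: "a \<in> arcs D" "endp X D a \<in> T" "endp (opp X) D a \<in> T'"
      using lk(1) unfolding linked_def by blast
    then have "a \<notin> C" using W lk C_D S(2) by (cases X) fastforce+
    moreover have "endp X G a = endp X D a" "endp (opp X) G a = endp (opp X) D a"
      using a lk sub(1) by (auto intro!: endp_U)
    ultimately show ?thesis
      using a lk by (intro linkedI[of a ?H X]) (auto simp: arcs_part_eq)
  qed
  have "conn ?H W"
    unfolding conn_def using l connD[OF sub(2)] by (metis Diff_subset)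
  moreover have "linked ?H W {t}" if t: "t \<in> (\<Union>X. endp X G ` (bnd X D W - C))" for t
  proof -
    obtain X a where a: "a \<in> bnd X D W - C" "t = endp X G a" using t by blast
    then have "endp (opp X) G a \<in> W" using bW anchor by auto
    then show ?thesis using a by (intro linkedI[of a ?H "opp X"]) (auto simp: arcs_part_eq bnd_def)
  qed
  ultimately have "conn ?H (W \<union> (\<Union>X. endp X G ` (bnd X D W - C)))" by (rule conn_Un_pendant)
  then show ?thesis by (simp add: weakly_connected_iff_conn part_def)
qed

lemma part_closed:
  assumes W: "W = V \<or> W = V'" and a: "a \<in> arcs G - C" and v: "endp X G a \<in> verts (part D G C W)"
  shows "a \<in> arcs (part D G C W)"
proof -
  have a': "a \<in> arcs (part D G C V) \<or> a \<in> arcs (part D G C V')" using a arcs_part(1) by blast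
  have "endp X G a \<in> verts (part D G C W')" if "a \<in> arcs (part D G C W')" "W' = V \<or> W' = V'" for W'
    using endp_in_verts[OF wf_part[OF that(2)] that(1), of X] by simp
  then show ?thesis using a' W v verts_part_disjoint by blast
qed

lemma subgraph_part:
  assumes W: "W = V \<or> W = V'" shows "subgraph (part D G C W) (remove_arcs G C)"
proof -
  have "wf_digraph (remove_arcs G C)"
    using wf_digraph by (auto simp: wf_digraph_def remove_arcs_def)
  moreover have "verts (part D G C W) \<subseteq> verts G" using W verts_part by blast
  moreover have "arcs (part D G C W) \<subseteq> arcs G - C" using W arcs_part by (auto simp: part_def)
  ultimately show ?thesis
    using wf_part[OF W] by (auto simp: subgraph_def compatible_def remove_arcs_def part_def)
qed

lemma endp_remove_arcs: "endp X (remove_arcs G C) = endp X G"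
  by (cases X) (auto simp: remove_arcs_def)

text \<open>Both parts are connected and contain every remaining arc that touches them, hence are
  components; together they cover all vertices, which leaves no room for a third.\<close>

lemma weak_components_eq: "weak_components (remove_arcs G C) = {part D G C V, part D G C V'}"
proof -
  have comp: "part D G C W \<in> weak_components (remove_arcs G C)"
    "\<And>K. K \<in> weak_components (remove_arcs G C) \<Longrightarrow> verts K \<inter> verts (part D G C W) \<noteq> {} \<Longrightarrow> K = part D G C W"
    if W: "W = V \<or> W = V'" for W
  proof -
    have cl: "\<forall>a \<in> arcs (remove_arcs G C). \<forall>X. endp X (remove_arcs G C) a \<in> verts (part D G C W) \<longrightarrow>
        a \<in> arcs (part D G C W)"
      unfolding endp_remove_arcs using part_closed[OF W] by (simp add: remove_arcs_def)
    have ne: "verts (part D G C W) \<noteq> {}" using W S(3,4) by (auto simp: part_def)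
    show "part D G C W \<in> weak_components (remove_arcs G C)"
      by (rule closed_subgraph_weak_component(1)[OF subgraph_part[OF W] cl ne weakly_connected_part[OF W]])
    show "K = part D G C W"
      if "K \<in> weak_components (remove_arcs G C)" "verts K \<inter> verts (part D G C W) \<noteq> {}" for K
      by (rule closed_subgraph_weak_component(2)[OF subgraph_part[OF W] cl ne weakly_connected_part[OF W] that])
  qed
  have "K = part D G C V \<or> K = part D G C V'" if K: "K \<in> weak_components (remove_arcs G C)" for K
  proof -
    have "verts K \<noteq> {}" "verts K \<subseteq> verts G"
      using K by (auto simp: weak_components_def pre_digraph.max_subgraph_def subgraph_def remove_arcs_def)
    then have "verts K \<inter> verts (part D G C V) \<noteq> {} \<or> verts K \<inter> verts (part D G C V') \<noteq> {}"
      using verts_part by blast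
    then show ?thesis using comp(2) K by blast
  qed
  then show ?thesis using comp(1) by blast
qed

lemma cocycle_C: "cocycle G C"
proof -
  let ?H = "part D G C V" and ?K = "part D G C V'"
  have V: "V \<subseteq> verts ?H" "V' \<subseteq> verts ?K" by (auto simp: part_def)
  have ne: "?H \<noteq> ?K" using V S(3) verts_part_disjoint by auto
  then have card: "card (weak_components (remove_arcs G C)) = 2" by (simp add: weak_components_eq)
  have C: "tail G a \<in> V" "head G a \<in> V'" if "a \<in> C" for a
    using C_D[OF that] endp_U[of a West] endp_U[of a East] V_sub by auto
  have "endp X G a \<notin> side_verts Y G" if "a \<in> C" for a X Y
  proof -
    have "endp X G a \<in> U" using C[OF that] V_sub by (cases X) auto
    then show ?thesis using endp_bnd by (auto simp: side_verts_eq)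
  qed
  moreover have "C \<subseteq> arcs G" using arcs_part(1) by blast
  ultimately have "C \<subseteq> inner_arcs G" unfolding inner_arcs_def side_arcs_def by blast
  moreover have "\<exists>H \<in> weak_components (remove_arcs G C). \<exists>K \<in> weak_components (remove_arcs G C).
      H \<noteq> K \<and> tail G a \<in> verts H \<and> head G a \<in> verts K" if "a \<in> C" for a
    unfolding weak_components_eq using ne C[OF that] V by blast
  moreover have "acyclic_digraph (component_digraph G C)"
  proof (rule acyclic_digraphI)
    \<comment> \<open>All arcs of \<open>C\<close> run from \<open>V\<close> to \<open>V'\<close>,
      so there is at most one arc between the components.\<close>
    have "arcs_ends (component_digraph G C) \<subseteq> {(?H, ?K)}"
    proof
      fix e assume "e \<in> arcs_ends (component_digraph G C)"
      then obtain H K a where e: "e = (H, K)" and HK: "H \<in> {?H, ?K}" "K \<in> {?H, ?K}" "H \<noteq> K"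
        and a: "a \<in> C" "tail G a \<in> verts H"
        by (auto simp: arcs_ends_conv component_digraph_def weak_components_eq)
      have "tail G a \<in> verts ?H" using C[OF a(1)] V by blast
      then have "H = ?H" using HK(1) a(2) verts_part_disjoint by blast
      then show "e \<in> {(?H, ?K)}" using HK e by blast
    qed
    moreover have "acyclic {(?H, ?K)}" using ne by (simp add: acyclic_insert wf_acyclic)
    ultimately show "acyclic (arcs_ends (component_digraph G C))" by (rule acyclic_subset[rotated])
  qed
  ultimately show ?thesis
    using card unfolding cocycle_def strict_cutset_def by simp
qed

end

text \<open>The cocycle condition of P''' enters only here. Any fresh \<nu> will do, because
  \<open>P_compatible_iff\<close> eliminates it; westward splittings are eastward ones with the
  halves exchanged.\<close>

lemma P3_graph_all_splittings_compatible:
  fixes D :: "('v::infinite, 'a) pre_digraph"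
  assumes P3: "P3_graph D" shows "all_splittings_compatible D (inner_verts D)"
proof -
  have D: "D_graph D" using P3 by (simp add: P3_graph_def)
  interpret piece D "inner_verts D" D by (rule piece_inner_verts[OF D])
  have eastward: "arc_compatible East D V V'" if split: "splitting East D (inner_verts D) V V'" for V V'
  proof -
    let ?C = "cross_arcs D V V'"
    have "finite ?C" using D_graphD(3)[OF D] by (simp add: cross_arcs_def)
    then obtain \<nu> :: "'a \<Rightarrow> 'v" where \<nu>: "inj_on \<nu> ?C" "\<nu> ` ?C \<inter> verts D = {}"
      using fresh_inj D_graphD(2)[OF D] by blast
    then interpret piece_cut D "inner_verts D" D V V' ?C \<nu> by unfold_locales (use split in simp_all)
    have "\<forall>a \<in> ?C. tail D a \<in> verts (part D D ?C V) \<and> head D a \<in> verts (part D D ?C V')"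
      using C_D by (auto simp: part_def)
    then have "P_compatible GW GE"
      using P3 cocycle_C weak_components_eq \<nu> unfolding P3_graph_def by blast
    then show ?thesis by (simp add: P_compatible_iff)
  qed
  show ?thesis
    unfolding all_splittings_compatible_def
  proof (intro allI impI)
    fix X V V' assume s: "splitting X D (inner_verts D) V V'"
    show "arc_compatible X D V V'"
    proof (cases X)
      case East
      then show ?thesis using eastward s by blast
    next
      case West
      then have "splitting East D (inner_verts D) V' V" using s
          splitting_commute[of West D "inner_verts D" V V'] by simp
      then have "arc_compatible East D V' V" by (rule eastward)
      then show ?thesis using arc_compatible_commute[of East] West by simp
    qed
  qed
qed

theorem theorem5p3p3:
  fixes D :: "('v::infinite, 'a) pre_digraph"
  assumes "P3_graph D"
  shows "P2_graph D"
  using piece_P2_graph piece_inner_verts P3_graph_all_splittings_compatible[OF assms] assms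
  unfolding P3_graph_def by blast

end
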